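(* Let $M\ge 0$ be an integer, let $\vec\omega=\langle\omega_0,\dots,\omega_M\rangle$ be a vector of $M+1$ distinct complex numbers with $\omega_i-\omega_j\notin\mathbb Z$ for all $i\neq j$, and let $\vec\rho=\langle\rho_0,\dots,\rho_M\rangle$ be a vector of $M+1$ nonnegative integers. Put $\sigma=\sum_{m=0}^M(\rho_m+1)$ and $\vec\rho\,!=\prod_{m=0}^M\rho_m!$. Then the Padé remainder $\mathrm{Rem}(z\mid\vec\omega;\vec\rho)$ is given by each of the following five expressions. (i) For $z\in\mathbb C\setminus[1,\infty)$, the iterated integral $$\frac{(1-z)^{\omega_0}}{\vec\rho\,!}\int_0^z\int_0^{t_1}\int_0^{t_2}\cdots\int_0^{t_{M-1}}\mathcal G(z,t_1,\dots,t_M)\,dt_M\cdots dt_2\,dt_1,$$ where $$\mathcal G(t_0,t_1,\dots,t_M)=t_M^{\rho_M}\left(\prod_{h=1}^M\left(\frac{t_{h-1}-t_h}{1-t_h}\right)^{\rho_{h-1}}\right)\left(\prod_{h=1}^M(1-t_h)^{\omega_h-\omega_{h-1}-1}\right).$$ (ii) For $z\in\mathbb C\setminus[1,\infty)$, the $M$-dimensional integral $$z^{\sigma-1}\frac{(1-z)^{\omega_0}}{\vec\rho\,!}\int_{[0,1]^M}U_M^{-1}\prod_{h=1}^M\frac{U_h^{1+\rho_h}}{(1-zU_h)^{1-\omega_h+\omega_{h-1}}}\left(\frac{1-u_h}{1-zU_h}\right)^{\rho_{h-1}}d\vec u,$$ where $U_m=\prod_{h=1}^m u_h$. (iii) For $z\in\mathbb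 C\setminus[1,\infty)$, the contour integral $$\frac{(-1)^{\sigma-1}}{2\pi i}\int_\gamma(1-z)^\xi\prod_{k=0}^M\frac{1}{(\xi-\omega_k)^{\underline{\rho_k+1}}}\,d\xi,$$ where $\gamma$ is any simple positively oriented contour enclosing all $\sigma$ of the complex numbers $\omega_m+r$ ($0\le m\le M$, $0\le r\le\rho_m$). (iv) The Maclaurin series of $\mathrm{Rem}(z\mid\vec\omega;\vec\rho)$ is $$\sum_{n=0}^\infty(-1)^n\sum_{m=0}^M\frac1{\rho_m!}\sum_{r=0}^{\rho_m}\binom{\rho_m}{r}\frac{(-1)^r(\omega_m+r)^{\underline n}}{\prod_{\substack{k=0\\k\ne m}}^M(\omega_k-\omega_m-r)^{\overline{\rho_k+1}}}\,\frac{z^n}{n!},$$ which converges for $|z|<1$. (v) For $|z|<1$ and $|1-z|<1$, the special value of Meijer's $G$-function $$G^{M+1,0}_{M+1,M+1}\left(1-z\,\middle|\,{\vec\omega+\vec\rho+1\atop\vec\omega}\right).$$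
   Context: Vectors are indexed by $0,\dots,M$; adding a scalar to a vector means adding it to each coordinate. For complex $\omega$, $(1-z)^\omega$ denotes the principal branch on $\mathbb C\setminus[1,\infty)$ (equal to $1$ at $z=0$). Falling and rising factorials: $x^{\underline r}=x(x-1)\cdots(x-r+1)$ and $x^{\overline r}=x(x+1)\cdots(x+r-1)$ for positive integers $r$, and $x^{\underline 0}=x^{\overline 0}=1$. Padé approximants and remainder: there are unique polynomials $H_0,\dots,H_M$ with $\deg H_m\le\rho_m$ such that $G(z)=\sum_{m=0}^M H_m(z)(1-z)^{\omega_m}$ has a zero of order $\sigma-1$ at $z=0$ and $\lim_{z\to0}G(z)/z^{\sigma-1}=1/(\sigma-1)!$ (in fact $\deg H_m=\rho_m$). One writes $\mathrm{Poly}_m(z\mid\vec\omega;\vec\rho):=H_m(z)$ (the Padé approximants) and $\mathrm{Rem}(z\mid\vec\omega;\vec\rho):=G(z)$ (the Padé remainder), a function analytic on $\mathbb C\setminus[1,\infty)$. In (i) the integrals are along straight line segments, $t_0=z$, and when $M=0$ there is no integration and the expression is $\frac{(1-z)^{\omega_0}}{\vec\rho\,!}\mathcal G(z)$; similarly in (ii), $U_0=1$ and for $M=0$ the integral is $1$. Meijer $G$-function: for natural numbers $m\le q$, $n\le p$, $$G^{m,n}_{p,q}\left(x\,\middle|\,{a_1,\dots,a_p\atop b_1,\dots,b_q}\right)=\frac1{2\pi i}\int_C\frac{\prod_{k=1}^m\Gamma(s+b_k)\prod_{k=1}^n\Gamma(1-a_k-s)}{\prod_{k=n+1}^p\Gamma(s+a_k)\prod_{k=m+1}^q\Gamma(1-b_k-s)}\,x^{-s}\,ds,$$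 where $C$ is an infinite contour separating the poles of the $\Gamma(1-a_k-s)$ from those of the $\Gamma(b_k+s)$; in the case used here ($n=0$, $m=p=q=M+1$, $0<|x|<1$), $C$ is the standard loop that begins and ends at infinity in the direction of the negative real axis and encircles all poles of the $\Gamma(b_k+s)$ once in the positive sense, and $x^{-s}$ is the principal branch. *)

theory Defs
  imports "HOL-Complex_Analysis.Complex_Analysis"
begin

text \<open>
  A vector with coordinates \<open>0, \<dots>, M\<close> is a function on \<^typ>\<open>nat\<close> of which only the values at
  arguments \<open>\<le> M\<close> are used. On the plane slit along \<open>[1, \<infinity>)\<close>, the principal branch of
  \<open>(1 - z)\<^sup>\<omega>\<close> is \<open>(1 - z) powr \<omega>\<close>. Rising factorials are \<^const>\<open>pochhammer\<close>.
\<close>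

definition slit_plane :: "complex set" where
  "slit_plane = - (complex_of_real ` {1..})"

definition ffact :: "complex \<Rightarrow> nat \<Rightarrow> complex" where
  "ffact x r = (\<Prod>i<r. x - of_nat i)"

definition vec_size :: "nat \<Rightarrow> (nat \<Rightarrow> nat) \<Rightarrow> nat" where
  "vec_size M \<rho> = (\<Sum>m\<le>M. \<rho> m + 1)"

definition vec_fact :: "nat \<Rightarrow> (nat \<Rightarrow> nat) \<Rightarrow> complex" where
  "vec_fact M \<rho> = (\<Prod>m\<le>M. fact (\<rho> m))"


section \<open>Pade approximants and remainder\<close>

definition pade_form :: "nat \<Rightarrow> (nat \<Rightarrow> complex) \<Rightarrow> (nat \<Rightarrow> complex poly) \<Rightarrow> complex \<Rightarrow> complex" where
  "pade_form M \<omega> H z = (\<Sum>m\<le>M. poly (H m) z * (1 - z) powr \<omega> m)"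

text \<open>The first conjunct only fixes the irrelevant values of \<open>H\<close>, so that \<open>H\<close> can be unique.\<close>

definition is_pade :: "nat \<Rightarrow> (nat \<Rightarrow> complex) \<Rightarrow> (nat \<Rightarrow> nat) \<Rightarrow> (nat \<Rightarrow> complex poly) \<Rightarrow> bool" where
  "is_pade M \<omega> \<rho> H \<longleftrightarrow>
     (\<forall>m>M. H m = 0) \<and>
     (\<forall>m\<le>M. degree (H m) \<le> \<rho> m) \<and>
     zorder (pade_form M \<omega> H) 0 = int (vec_size M \<rho> - 1) \<and>
     ((\<lambda>z. pade_form M \<omega> H z / z ^ (vec_size M \<rho> - 1))
        \<longlongrightarrow> 1 / fact (vec_size M \<rho> - 1)) (at 0)"

definition Pade_Poly :: "nat \<Rightarrow> (nat \<Rightarrow> complex) \<Rightarrow> (nat \<Rightarrow> nat) \<Rightarrow> nat \<Rightarrow> complex poly" where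
  "Pade_Poly M \<omega> \<rho> = (THE H. is_pade M \<omega> \<rho> H)"

definition Pade_Rem :: "nat \<Rightarrow> (nat \<Rightarrow> complex) \<Rightarrow> (nat \<Rightarrow> nat) \<Rightarrow> complex \<Rightarrow> complex" where
  "Pade_Rem M \<omega> \<rho> = pade_form M \<omega> (Pade_Poly M \<omega> \<rho>)"


section \<open>Iterated integrals along segments\<close>

text \<open>
  \<open>iter_integral f k d t\<close> is the \<open>d\<close>-fold integral of \<open>f\<close> over \<open>t\<^bsub>k+1\<^esub>, \<dots>, t\<^bsub>k+d\<^esub>\<close>
  (outermost first), \<open>t\<^bsub>j+1\<^esub>\<close> running along the segment from \<open>0\<close> to \<open>t\<^bsub>j\<^esub>\<close>; the coordinates
  of index \<open>\<le> k\<close> are those of \<open>t\<close>. \<open>iter_integrable\<close> says that all the integrals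
  involved exist.
\<close>

primrec iter_integral ::
  "((nat \<Rightarrow> complex) \<Rightarrow> complex) \<Rightarrow> nat \<Rightarrow> nat \<Rightarrow> (nat \<Rightarrow> complex) \<Rightarrow> complex" where
  "iter_integral f k 0 t = f t"
| "iter_integral f k (Suc d) t =
     contour_integral (linepath 0 (t k)) (\<lambda>s. iter_integral f (Suc k) d (t(Suc k := s)))"

primrec iter_integrable ::
  "((nat \<Rightarrow> complex) \<Rightarrow> complex) \<Rightarrow> nat \<Rightarrow> nat \<Rightarrow> (nat \<Rightarrow> complex) \<Rightarrow> bool" where
  "iter_integrable f k 0 t \<longleftrightarrow> True"
| "iter_integrable f k (Suc d) t \<longleftrightarrow>
     (\<lambda>s. iter_integral f (Suc k) d (t(Suc k := s))) contour_integrable_on linepath 0 (t k) \<and>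
     (\<forall>s \<in> closed_segment 0 (t k). iter_integrable f (Suc k) d (t(Suc k := s)))"

definition segment_integrand ::
  "nat \<Rightarrow> (nat \<Rightarrow> complex) \<Rightarrow> (nat \<Rightarrow> nat) \<Rightarrow> (nat \<Rightarrow> complex) \<Rightarrow> complex" where
  "segment_integrand M \<omega> \<rho> t =
     t M ^ \<rho> M *
     (\<Prod>h=1..M. ((t (h - 1) - t h) / (1 - t h)) ^ \<rho> (h - 1)) *
     (\<Prod>h=1..M. (1 - t h) powr (\<omega> h - \<omega> (h - 1) - 1))"


section \<open>Integral over the unit cube\<close>

definition partial_prod :: "(nat \<Rightarrow> real) \<Rightarrow> nat \<Rightarrow> complex" where
  "partial_prod u m = (\<Prod>h=1..m. complex_of_real (u h))"

definition cube_integrand ::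
  "nat \<Rightarrow> (nat \<Rightarrow> complex) \<Rightarrow> (nat \<Rightarrow> nat) \<Rightarrow> complex \<Rightarrow> (nat \<Rightarrow> real) \<Rightarrow> complex" where
  "cube_integrand M \<omega> \<rho> z u =
     inverse (partial_prod u M) *
     (\<Prod>h=1..M.
        partial_prod u h ^ (1 + \<rho> h) /
          (1 - z * partial_prod u h) powr (1 - \<omega> h + \<omega> (h - 1)) *
        ((1 - complex_of_real (u h)) / (1 - z * partial_prod u h)) ^ \<rho> (h - 1))"


section \<open>Closed contours\<close>

definition simple_pos_contour :: "(real \<Rightarrow> complex) \<Rightarrow> bool" where
  "simple_pos_contour \<gamma> \<longleftrightarrow>
     valid_path \<gamma> \<and> simple_path \<gamma> \<and> pathfinish \<gamma> = pathstart \<gamma> \<and>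
     (\<forall>w \<in> inside (path_image \<gamma>). winding_number \<gamma> w = 1)"


section \<open>The Meijer G-function\<close>

text \<open>
  The parameters are lists, so \<open>p = length as\<close> and \<open>q = length bs\<close>, with \<open>n \<le> p\<close>, \<open>m \<le> q\<close>.
  As \<^const>\<open>Gamma\<close> is \<open>0\<close> at its poles, the divisions below give the correct value \<open>0\<close>
  of \<open>1/\<Gamma>\<close> there.
\<close>

definition meijer_integrand ::
  "nat \<Rightarrow> nat \<Rightarrow> complex list \<Rightarrow> complex list \<Rightarrow> complex \<Rightarrow> complex \<Rightarrow> complex" where
  "meijer_integrand m n as bs x s =
     ((\<Prod>k<m. Gamma (s + bs ! k)) * (\<Prod>k<n. Gamma (1 - as ! k - s))) /
     ((\<Prod>k=n..<length as. Gamma (s + as ! k)) *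
      (\<Prod>k=m..<length bs. Gamma (1 - bs ! k - s))) *
     x powr (- s)"

definition meijer_left_poles :: "nat \<Rightarrow> complex list \<Rightarrow> complex set" where
  "meijer_left_poles m bs = {- (bs ! k) - of_nat j | k j. k < m}"

definition meijer_right_poles :: "nat \<Rightarrow> complex list \<Rightarrow> complex set" where
  "meijer_right_poles n as = {1 - as ! k + of_nat j | k j. k < n}"

text \<open>
  A loop from and to infinity in the direction of the negative real axis is given by its middle
  part \<open>\<gamma>\<close>: it comes in along the horizontal ray from \<open>-\<infinity>\<close> to the start of \<open>\<gamma>\<close>, follows \<open>\<gamma>\<close>,
  and leaves along the horizontal ray from the end of \<open>\<gamma>\<close> to \<open>-\<infinity>\<close>. The next two paths are its
  truncation to real parts \<open>\<ge> -R\<close> on the rays, and that truncation closed up by a vertical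
  segment.
\<close>

definition loop_trunc :: "(real \<Rightarrow> complex) \<Rightarrow> real \<Rightarrow> real \<Rightarrow> complex" where
  "loop_trunc \<gamma> R =
     linepath (Complex (- R) (Im (pathstart \<gamma>))) (pathstart \<gamma>) +++
     \<gamma> +++
     linepath (pathfinish \<gamma>) (Complex (- R) (Im (pathfinish \<gamma>)))"

definition loop_closed :: "(real \<Rightarrow> complex) \<Rightarrow> real \<Rightarrow> real \<Rightarrow> complex" where
  "loop_closed \<gamma> R =
     loop_trunc \<gamma> R +++
     linepath (Complex (- R) (Im (pathfinish \<gamma>))) (Complex (- R) (Im (pathstart \<gamma>)))"

text \<open>
  The loop encircles every pole of the \<open>\<Gamma>(b\<^sub>k + s)\<close> once in the positive sense, none of the
  poles of the \<open>\<Gamma>(1 - a\<^sub>k - s)\<close>, and passes through none of these points.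
\<close>

definition meijer_loop ::
  "nat \<Rightarrow> nat \<Rightarrow> complex list \<Rightarrow> complex list \<Rightarrow> (real \<Rightarrow> complex) \<Rightarrow> bool" where
  "meijer_loop m n as bs \<gamma> \<longleftrightarrow>
     valid_path \<gamma> \<and>
     (\<forall>p \<in> meijer_left_poles m bs. \<forall>\<^sub>F R in at_top.
        p \<notin> path_image (loop_closed \<gamma> R) \<and> winding_number (loop_closed \<gamma> R) p = 1) \<and>
     (\<forall>p \<in> meijer_right_poles n as. \<forall>\<^sub>F R in at_top.
        p \<notin> path_image (loop_closed \<gamma> R) \<and> winding_number (loop_closed \<gamma> R) p = 0)"

text \<open>
  The G-function, in the cases where the loop above is an admissible contour: \<open>p < q\<close>, or
  \<open>p = q\<close> and \<open>0 < \<bar>x\<bar> < 1\<close>. It is the common value of the integral for all such loops.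
\<close>

definition meijer_G ::
  "nat \<Rightarrow> nat \<Rightarrow> complex list \<Rightarrow> complex list \<Rightarrow> complex \<Rightarrow> complex" where
  "meijer_G m n as bs x =
     (THE I. (\<exists>\<gamma>. meijer_loop m n as bs \<gamma>) \<and>
       (\<forall>\<gamma>. meijer_loop m n as bs \<gamma> \<longrightarrow>
          ((\<lambda>R. 1 / (2 * of_real pi * \<i>) *
             contour_integral (loop_trunc \<gamma> R) (meijer_integrand m n as bs x)) \<longlongrightarrow> I) at_top))"

end

theory Submission
  imports Defs
begin

text \<open>
  Let \<open>X\<close> be the set of the \<open>\<sigma>\<close> nodes \<open>\<omega>\<^bsub>m\<^esub> + r\<close>. The remainder is, up to sign, the divided
  difference of \<open>\<xi> \<mapsto> (1 - z)\<^sup>\<xi>\<close> at \<open>X\<close>: its Maclaurin coefficients are divided differences of the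
  falling factorials, which vanish below degree \<open>\<sigma> - 1\<close> by Lagrange interpolation. Conversely a
  combination of the \<open>(1 - z)\<^sup>x\<close>, \<open>x \<in> X\<close>, that vanishes to order \<open>\<sigma>\<close> at \<open>0\<close> has all moments of
  degree \<open>< \<sigma>\<close> equal to \<open>0\<close>, hence is trivial; this gives uniqueness.

  The contour integral is the residue form of the divided difference. Since a quotient
  \<open>\<Gamma>(s + \<omega>) / \<Gamma>(s + \<omega> + \<rho> + 1)\<close> is the reciprocal of a rising factorial, the Meijer integrand is
  the same rational function at \<open>\<xi> = -s\<close>, and the segment closing the truncated loop contributes
  exponentially little because \<open>|1 - z| < 1\<close>. For the iterated integral, the nodes are split
  into those of \<open>\<omega>\<^bsub>k\<^esub>\<close> and those of larger index: by partial fractions the divided difference of a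
  disjoint union is a convolution of the two divided differences, and the block of \<open>\<omega>\<^bsub>k\<^esub>\<close> sums up to
  the kernel \<open>((t - s)/(1 - s))\<^bsup>\<rho>\<^esup>\<close> by the binomial theorem.
\<close>


section \<open>Partial fractions and Lagrange interpolation\<close>

text \<open>The barycentric weights of Lagrange interpolation, with differences \<open>y - x\<close>
  instead of \<open>x - y\<close>. With this sign the weights of the nodes are built from rising
  factorials, as in the Maclaurin coefficients.\<close>

definition wt :: "complex set \<Rightarrow> complex \<Rightarrow> complex" where
  "wt X x = 1 / (\<Prod>y\<in>X - {x}. y - x)"

lemma poly_eq_lagrange:
  assumes "finite X" "degree Q < card X"
  shows "Q = (\<Sum>x\<in>X. smult (poly Q x * wt X x) (\<Prod>y\<in>X - {x}. [:y, -1:]))"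
proof (rule poly_eqI_degree[where A = X])
  fix a assume a: "a \<in> X"
  have "poly (\<Sum>x\<in>X. smult (poly Q x * wt X x) (\<Prod>y\<in>X - {x}. [:y, -1:])) a
      = (\<Sum>x\<in>X. if x = a then poly Q a else 0)"
    unfolding poly_sum poly_smult poly_prod
  proof (rule sum.cong[OF refl])
    fix x assume x: "x \<in> X"
    show "poly Q x * wt X x * (\<Prod>y\<in>X - {x}. poly [:y, -1:] a) = (if x = a then poly Q a else 0)"
    proof (cases "x = a")
      case False
      hence "(\<Prod>y\<in>X - {x}. y - a) = 0" using a assms(1) by (intro prod_zero) auto
      thus ?thesis using False by simp
    next
      case True
      have "(\<Prod>y\<in>X - {a}. y - a) \<noteq> 0" using assms(1) by auto
      thus ?thesis using True by (simp add: wt_def)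
    qed
  qed
  also have "\<dots> = poly Q a" using a assms(1) by simp
  finally show "poly Q a = poly (\<Sum>x\<in>X. smult (poly Q x * wt X x) (\<Prod>y\<in>X - {x}. [:y, -1:])) a" ..
next
  show "degree Q < card X" by fact
  have "degree (smult (poly Q x * wt X x) (\<Prod>y\<in>X - {x}. [:y, -1:])) \<le> card X - 1" if "x \<in> X" for x
  proof -
    have "degree (\<Prod>y\<in>X - {x}. [:y, -1:]) \<le> sum (degree \<circ> (\<lambda>y. [:y, -1:])) (X - {x})"
      using assms(1) by (intro degree_prod_sum_le) auto
    also have "\<dots> = card X - 1" using that assms(1) by simp
    finally show ?thesis by (rule order.trans[OF degree_smult_le])
  qed
  hence "degree (\<Sum>x\<in>X. smult (poly Q x * wt X x) (\<Prod>y\<in>X - {x}. [:y, -1:])) \<le> card X - 1"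
    by (intro degree_sum_le assms(1)) auto
  thus "degree (\<Sum>x\<in>X. smult (poly Q x * wt X x) (\<Prod>y\<in>X - {x}. [:y, -1:])) < card X"
    using assms(2) by linarith
qed

text \<open>Comparison of the coefficients of degree \<open>card X - 1\<close> in the Lagrange
  formula: each basis polynomial is a product of \<open>card X - 1\<close> factors with leading
  coefficient \<open>-1\<close>. The sum thus vanishes on polynomials of smaller degree, which is
  what gives the remainder its high order of vanishing.\<close>

lemma sum_wt_poly:
  assumes "finite X" "degree Q < card X"
  shows "(\<Sum>x\<in>X. wt X x * poly Q x) = (- 1) ^ (card X - 1) * coeff Q (card X - 1)"
proof -
  have lead: "coeff (\<Prod>y\<in>X - {x}. [:y, -1:]) (card X - 1) = (- 1) ^ (card X - 1)" if "x \<in> X" for x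
  proof -
    have "degree (\<Prod>y\<in>X - {x}. [:y, -1 :: complex:]) = card X - 1"
      using that assms(1) by (subst degree_prod_sum_eq) auto
    hence "coeff (\<Prod>y\<in>X - {x}. [:y, -1:]) (card X - 1) = lead_coeff (\<Prod>y\<in>X - {x}. [:y, -1:])"
      by simp
    also have "\<dots> = (- 1) ^ (card X - 1)"
      using that assms(1) by (simp add: lead_coeff_prod)
    finally show ?thesis .
  qed
  have "coeff Q (card X - 1) = (\<Sum>x\<in>X. poly Q x * wt X x * (- 1) ^ (card X - 1))"
    by (subst poly_eq_lagrange[OF assms], unfold coeff_sum coeff_smult)
       (intro sum.cong refl, simp only: lead)
  also have "\<dots> = (- 1) ^ (card X - 1) * (\<Sum>x\<in>X. wt X x * poly Q x)"
    by (simp add: sum_distrib_left mult_ac)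
  finally show ?thesis by (simp flip: mult.assoc power_mult_distrib)
qed

text \<open>Lagrange interpolation of the constant \<open>1\<close>, evaluated at
  \<open>\<xi>\<close> and divided by the full product.\<close>

lemma partial_fractions:
  assumes "finite X" "X \<noteq> {}" "\<xi> \<notin> X"
  shows "1 / (\<Prod>x\<in>X. x - \<xi>) = (\<Sum>x\<in>X. wt X x / (x - \<xi>))"
proof -
  have nz: "(\<Prod>x\<in>X. x - \<xi>) \<noteq> 0" using assms by auto
  have "1 = poly 1 \<xi>" by simp
  also have "(1 :: complex poly) = (\<Sum>x\<in>X. smult (poly 1 x * wt X x) (\<Prod>y\<in>X - {x}. [:y, -1:]))"
    using assms by (intro poly_eq_lagrange) (auto simp: card_gt_0_iff)
  also have "poly \<dots> \<xi> = (\<Sum>x\<in>X. wt X x * (\<Prod>y\<in>X - {x}. y - \<xi>))"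
    by (simp add: poly_sum poly_prod)
  also have "\<dots> = (\<Sum>x\<in>X. wt X x / (x - \<xi>) * (\<Prod>x\<in>X. x - \<xi>))"
  proof (rule sum.cong[OF refl])
    fix x assume x: "x \<in> X"
    hence "x - \<xi> \<noteq> 0" using assms(3) by auto
    thus "wt X x * (\<Prod>y\<in>X - {x}. y - \<xi>) = wt X x / (x - \<xi>) * (\<Prod>x\<in>X. x - \<xi>)"
      by (subst prod.remove[OF assms(1) x]) simp
  qed
  finally show ?thesis using nz by (simp add: field_simps sum_distrib_left)
qed

lemma wt_Un:
  assumes "finite X" "finite Y" "X \<inter> Y = {}" "x \<in> X"
  shows "wt (X \<union> Y) x = wt X x / (\<Prod>y\<in>Y. y - x)"
proof -
  have "X \<union> Y - {x} = (X - {x}) \<union> Y" using assms by auto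
  thus ?thesis using assms by (simp add: wt_def prod.union_disjoint disjoint_iff)
qed

text \<open>Up to the sign \<open>(-1)\<^bsup>|X| - 1\<^esup>\<close>, the divided difference of \<open>f\<close> at the points of \<open>X\<close>.\<close>

definition dd :: "complex set \<Rightarrow> (complex \<Rightarrow> complex) \<Rightarrow> complex" where
  "dd X f = (\<Sum>x\<in>X. wt X x * f x)"

text \<open>Partial fractions split the integrand into multiples of
  \<open>f \<xi> / (\<xi> - x)\<close>, to which Cauchy's formula applies one node at a time; the
  minus sign comes from \<open>x - \<xi>\<close>. Only winding numbers at the nodes are prescribed,
  so the result serves both simple contours and closed-up Meijer loops.\<close>

lemma has_contour_integral_dd:
  assumes "finite X" "X \<noteq> {}" "f holomorphic_on UNIV"
    and "valid_path \<gamma>" "pathfinish \<gamma> = pathstart \<gamma>" "X \<inter> path_image \<gamma> = {}"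
    and "\<And>x. x \<in> X \<Longrightarrow> winding_number \<gamma> x = 1"
  shows "((\<lambda>\<xi>. f \<xi> / (\<Prod>x\<in>X. x - \<xi>)) has_contour_integral - (2 * of_real pi * \<i>) * dd X f) \<gamma>"
proof -
  have "((\<lambda>\<xi>. - wt X x * (f \<xi> / (\<xi> - x))) has_contour_integral
          - wt X x * (2 * of_real pi * \<i> * 1 * f x)) \<gamma>" if "x \<in> X" for x
  proof -
    have "((\<lambda>\<xi>. f \<xi> / (\<xi> - x)) has_contour_integral
            (2 * of_real pi * \<i> * winding_number \<gamma> x * f x)) \<gamma>"
      using Cauchy_integral_formula_convex_simple[of UNIV f x \<gamma>] assms that by auto
    thus ?thesis unfolding assms(7)[OF that] by (rule has_contour_integral_lmul)
  qed
  hence "((\<lambda>\<xi>. \<Sum>x\<in>X. - wt X x * (f \<xi> / (\<xi> - x))) has_contour_integral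
          (\<Sum>x\<in>X. - wt X x * (2 * of_real pi * \<i> * 1 * f x))) \<gamma>"
    by (intro has_contour_integral_sum assms(1)) auto
  also have "(\<Sum>x\<in>X. - wt X x * (2 * of_real pi * \<i> * 1 * f x)) = - (2 * of_real pi * \<i>) * dd X f"
    by (simp add: dd_def sum_distrib_left sum_negf mult_ac)
  finally show ?thesis
  proof (rule has_contour_integral_eq)
    fix \<xi> assume "\<xi> \<in> path_image \<gamma>"
    hence "\<xi> \<notin> X" using assms(6) by auto
    have "(\<Sum>x\<in>X. - wt X x * (f \<xi> / (\<xi> - x))) = f \<xi> * (\<Sum>x\<in>X. wt X x / (x - \<xi>))"
      unfolding sum_distrib_left
      by (intro sum.cong refl) (metis (no_types, opaque_lifting) minus_diff_eq minus_divide_right mult.commute mult_minus_right times_divide_eq_left times_divide_eq_right)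
    also have "\<dots> = f \<xi> / (\<Prod>x\<in>X. x - \<xi>)"
      using partial_fractions[OF assms(1,2) \<open>\<xi> \<notin> X\<close>] by (metis mult.right_neutral times_divide_eq_right)
    finally show "(\<Sum>x\<in>X. - wt X x * (f \<xi> / (\<xi> - x))) = f \<xi> / (\<Prod>x\<in>X. x - \<xi>)" .
  qed
qed


section \<open>The nodes\<close>

definition node_block :: "complex \<Rightarrow> nat \<Rightarrow> complex set" where
  "node_block w n = (\<lambda>r. w + of_nat r) ` {..n}"

definition node_set :: "(nat \<Rightarrow> complex) \<Rightarrow> (nat \<Rightarrow> nat) \<Rightarrow> nat set \<Rightarrow> complex set" where
  "node_set \<omega> \<rho> I = (\<Union>m\<in>I. node_block (\<omega> m) (\<rho> m))"

text \<open>Relative to an index set because the integral recurrence works with the tails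
  \<open>{k..M}\<close>.\<close>

definition noncongruent :: "(nat \<Rightarrow> complex) \<Rightarrow> nat set \<Rightarrow> bool" where
  "noncongruent \<omega> I \<longleftrightarrow> (\<forall>i\<in>I. \<forall>j\<in>I. i \<noteq> j \<longrightarrow> \<omega> i - \<omega> j \<notin> \<int>)"

lemma noncongruent_subset: "noncongruent \<omega> I \<Longrightarrow> J \<subseteq> I \<Longrightarrow> noncongruent \<omega> J"
  by (auto simp: noncongruent_def)

lemma finite_node_block [simp]: "finite (node_block w n)"
  and node_block_nonempty [simp]: "node_block w n \<noteq> {}"
  by (auto simp: node_block_def)

lemma finite_node_set [simp]: "finite I \<Longrightarrow> finite (node_set \<omega> \<rho> I)"
  by (auto simp: node_set_def)

lemma node_set_eq_empty_iff [simp]: "node_set \<omega> \<rho> I = {} \<longleftrightarrow> I = {}"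
  by (auto simp: node_set_def)

lemma node_block_disjoint:
  assumes "w - v \<notin> \<int>"
  shows "node_block w n \<inter> node_block v k = {}"
proof (rule ccontr)
  assume "\<not> ?thesis"
  then obtain i j where "w + of_nat i = v + of_nat j" by (auto simp: node_block_def)
  hence "w - v = of_int (int j - int i)" by (simp add: algebra_simps)
  thus False using assms by auto
qed

lemma node_block_set_disjoint:
  assumes "noncongruent \<omega> (insert k I)" "k \<notin> I"
  shows "node_block (\<omega> k) (\<rho> k) \<inter> node_set \<omega> \<rho> I = {}"
  using assms node_block_disjoint unfolding noncongruent_def node_set_def
  by (fastforce simp: Int_UN_distrib)

lemma inj_on_node: "inj_on (\<lambda>r. w + (of_nat r :: complex)) A"
  by (auto simp: inj_on_def)

lemma prod_node_block: "(\<Prod>x\<in>node_block w n. g x) = (\<Prod>i\<le>n. g (w + of_nat i))"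
  unfolding node_block_def by (subst prod.reindex) (auto simp: inj_on_node)

lemma prod_node_set:
  assumes "finite I" "noncongruent \<omega> I"
  shows "(\<Prod>x\<in>node_set \<omega> \<rho> I. g x) = (\<Prod>m\<in>I. \<Prod>i\<le>\<rho> m. g (\<omega> m + of_nat i))"
  unfolding node_set_def
  by (subst prod.UNION_disjoint)
     (use assms node_block_disjoint in \<open>auto simp: prod_node_block noncongruent_def\<close>)

lemma sum_node_block: "(\<Sum>x\<in>node_block w n. g x) = (\<Sum>i\<le>n. g (w + of_nat i))"
  unfolding node_block_def by (subst sum.reindex) (auto simp: inj_on_node)

lemma sum_node_set:
  assumes "finite I" "noncongruent \<omega> I"
  shows "(\<Sum>x\<in>node_set \<omega> \<rho> I. g x) = (\<Sum>m\<in>I. \<Sum>i\<le>\<rho> m. g (\<omega> m + of_nat i))"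
  unfolding node_set_def
  by (subst sum.UNION_disjoint)
     (use assms node_block_disjoint in \<open>auto simp: sum_node_block noncongruent_def\<close>)

lemma card_node_set:
  assumes "finite I" "noncongruent \<omega> I"
  shows "card (node_set \<omega> \<rho> I) = (\<Sum>m\<in>I. \<rho> m + 1)"
  using sum_node_set[OF assms, of "\<lambda>_. 1::nat"] by simp

text \<open>The \<open>r\<close> factors with \<open>i < r\<close> are negative and contribute
  \<open>(-1)^r r!\<close>; those with \<open>i > r\<close> contribute
  \<open>(n - r)!\<close>.\<close>

lemma prod_diff_factorial:
  assumes "r \<le> n"
  shows "(\<Prod>i\<in>{..n} - {r}. of_nat i - of_nat r) = (- 1) ^ r * (fact r * fact (n - r) :: complex)"
proof -
  have *: "{..n} - {r} = {..<r} \<union> (\<lambda>j. Suc (r + j)) ` {..<n - r}"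
  proof -
    have "i \<in> (\<lambda>j. Suc (r + j)) ` {..<n - r}" if "i \<le> n" "i > r" for i
      using that by (intro image_eqI[of _ _ "i - Suc r"]) auto
    thus ?thesis using assms by fastforce
  qed
  have "(\<Prod>i<r. of_nat i - of_nat r :: complex) = (\<Prod>i<r. - of_nat (Suc (r - Suc i)))"
    by (intro prod.cong) (auto simp: of_nat_diff)
  also have "\<dots> = (- 1) ^ r * (\<Prod>i<r. of_nat (Suc (r - Suc i)))"
    by (subst prod_uminus) simp
  also have "(\<Prod>i<r. of_nat (Suc (r - Suc i)) :: complex) = (\<Prod>i<r. of_nat (Suc i))"
    by (rule prod.nat_diff_reindex)
  also have "\<dots> = fact r" by (simp add: fact_prod_Suc atLeast0LessThan)
  finally have 1: "(\<Prod>i<r. of_nat i - of_nat r :: complex) = (- 1) ^ r * fact r" .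
  have 2: "(\<Prod>i\<in>(\<lambda>j. Suc (r + j)) ` {..<n - r}. of_nat i - of_nat r :: complex) = fact (n - r)"
    by (subst prod.reindex) (auto simp: inj_on_def fact_prod_Suc atLeast0LessThan)
  show ?thesis unfolding *
    by (subst prod.union_disjoint) (auto simp: 1 2)
qed

text \<open>The nodes of one block are equally spaced, so its divided difference is a multiple of
  the finite difference of order \<open>n\<close>; hence the alternating binomial
  coefficients.\<close>

lemma wt_node_block:
  assumes "r \<le> n"
  shows "wt (node_block w n) (w + of_nat r) = of_nat (n choose r) * (- 1) ^ r / fact n"
proof -
  have "node_block w n - {w + of_nat r} = (\<lambda>i. w + of_nat i) ` ({..n} - {r})"
    by (auto simp: node_block_def)
  hence "(\<Prod>y\<in>node_block w n - {w + of_nat r}. y - (w + of_nat r))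
       = (\<Prod>i\<in>{..n} - {r}. of_nat i - of_nat r)"
    by (simp add: prod.reindex inj_on_node)
  hence "wt (node_block w n) (w + of_nat r) = 1 / ((- 1) ^ r * (fact r * fact (n - r)))"
    by (simp add: wt_def prod_diff_factorial[OF assms])
  also have "\<dots> = of_nat (n choose r) * (- 1) ^ r / fact n"
    using assms by (cases "even r") (simp_all add: binomial_fact field_simps)
  finally show ?thesis .
qed

text \<open>The block containing the node contributes its binomial weight, and the product of the
  differences to any other block is a rising factorial. The factors are grouped as in the Maclaurin
  coefficients of the theorem.\<close>

lemma wt_node_set:
  assumes "finite I" "noncongruent \<omega> I" "m \<in> I" "r \<le> \<rho> m"
  shows "wt (node_set \<omega> \<rho> I) (\<omega> m + of_nat r) = 1 / fact (\<rho> m) * (of_nat (\<rho> m choose r) *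
    ((- 1) ^ r / (\<Prod>k\<in>I - {m}. pochhammer (\<omega> k - \<omega> m - of_nat r) (\<rho> k + 1))))"
proof -
  have I: "insert m (I - {m}) = I" using assms by auto
  have "node_set \<omega> \<rho> I = node_block (\<omega> m) (\<rho> m) \<union> node_set \<omega> \<rho> (I - {m})"
    using assms(3) by (auto simp: node_set_def)
  moreover have "wt (node_block (\<omega> m) (\<rho> m) \<union> node_set \<omega> \<rho> (I - {m})) (\<omega> m + of_nat r)
      = wt (node_block (\<omega> m) (\<rho> m)) (\<omega> m + of_nat r) /
        (\<Prod>y\<in>node_set \<omega> \<rho> (I - {m}). y - (\<omega> m + of_nat r))"
    using assms by (intro wt_Un node_block_set_disjoint) (auto simp: I insert_absorb node_block_def)
  moreover have "(\<Prod>y\<in>node_set \<omega> \<rho> (I - {m}). y - (\<omega> m + of_nat r))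
      = (\<Prod>k\<in>I - {m}. pochhammer (\<omega> k - \<omega> m - of_nat r) (\<rho> k + 1))"
    using assms noncongruent_subset[OF assms(2), of "I - {m}"]
    by (subst prod_node_set) (auto simp: pochhammer_Suc_prod atLeast0AtMost algebra_simps)
  ultimately show ?thesis using wt_node_block[OF assms(4)] by simp
qed

section \<open>The slit plane\<close>

lemma slit_plane_iff: "z \<in> slit_plane \<longleftrightarrow> 1 - z \<notin> \<real>\<^sub>\<le>\<^sub>0"
proof -
  have "z \<in> complex_of_real ` {1..} \<longleftrightarrow> Re z \<ge> 1 \<and> Im z = 0"
    by (auto simp: complex_eq_iff intro!: image_eqI[of _ _ "Re z"])
  thus ?thesis by (simp add: slit_plane_def complex_nonpos_Reals_iff)
qed

lemma unit_disc_slit_plane: "norm z < 1 \<Longrightarrow> z \<in> slit_plane"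
  using complex_Re_le_cmod[of z] by (auto simp: slit_plane_iff complex_nonpos_Reals_iff)


section \<open>The remainder and its Maclaurin series\<close>

definition rem :: "complex set \<Rightarrow> complex \<Rightarrow> complex" where
  "rem X t = dd X (\<lambda>x. (1 - t) powr x)"

definition rem_coeff :: "complex set \<Rightarrow> nat \<Rightarrow> complex" where
  "rem_coeff X n = (- 1) ^ n * dd X (\<lambda>x. ffact x n)"

lemma powr_one_minus_sums:
  assumes "norm t < 1"
  shows "(\<lambda>n. (- 1) ^ n * ffact x n * (t ^ n / fact n)) sums ((1 - t) powr x)"
proof -
  have "(\<lambda>n. (x gchoose n) * (- t) ^ n) sums (1 + - t) powr x"
    using assms by (intro gen_binomial_complex) auto
  thus ?thesis
    by (simp add: gbinomial_prod_rev ffact_def atLeast0LessThan power_minus[of t] mult_ac)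
qed

lemma sum_powr_sums:
  assumes "norm t < 1"
  shows "(\<lambda>n. ((- 1) ^ n * (\<Sum>p\<in>A. a p * ffact (x p) n)) * (t ^ n / fact n)) sums
    (\<Sum>p\<in>A. a p * (1 - t) powr x p)"
proof -
  have "(\<lambda>n. \<Sum>p\<in>A. a p * ((- 1) ^ n * ffact (x p) n * (t ^ n / fact n))) sums
    (\<Sum>p\<in>A. a p * (1 - t) powr x p)"
    by (intro sums_sum sums_mult powr_one_minus_sums assms)
  thus ?thesis by (simp add: sum_distrib_left sum_distrib_right mult_ac)
qed

lemma rem_sums: "norm t < 1 \<Longrightarrow> (\<lambda>n. rem_coeff X n * (t ^ n / fact n)) sums rem X t"
  unfolding rem_def rem_coeff_def dd_def by (rule sum_powr_sums)

lemma higher_deriv_of_sums: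
  fixes f :: "complex \<Rightarrow> complex"
  assumes "\<And>t. norm t < 1 \<Longrightarrow> (\<lambda>n. c n * (t ^ n / fact n)) sums f t"
  shows "(deriv ^^ n) f 0 = c n"
proof -
  have "f has_fps_expansion Abs_fps (\<lambda>n. c n / fact n)"
  proof (rule has_fps_expansionI)
    have "eventually (\<lambda>u. u \<in> ball 0 1) (nhds (0::complex))"
      by (intro eventually_nhds_in_open) auto
    thus "\<forall>\<^sub>F u in nhds 0. (\<lambda>n. fps_nth (Abs_fps (\<lambda>n. c n / fact n)) n * u ^ n) sums f u"
      by eventually_elim (use assms in \<open>auto simp: mult_ac\<close>)
  qed
  from fps_nth_fps_expansion[OF this, of n] show ?thesis by (simp add: field_simps)
qed

section \<open>Vanishing of the low Maclaurin coefficients\<close>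

lemma ffact_eq_poly: "ffact x n = poly (\<Prod>i<n. [:- of_nat i, 1:]) x"
  by (simp add: ffact_def poly_prod)

lemma
  shows degree_ffact_poly: "degree (\<Prod>i<n. [:- of_nat i, 1 :: complex:]) = n"
    and lead_coeff_ffact_poly: "coeff (\<Prod>i<n. [:- of_nat i, 1 :: complex:]) n = 1"
proof -
  show *: "degree (\<Prod>i<n. [:- of_nat i, 1 :: complex:]) = n"
    by (subst degree_prod_sum_eq) auto
  have "lead_coeff (\<Prod>i<n. [:- of_nat i, 1 :: complex:]) = 1"
    by (simp add: lead_coeff_prod)
  thus "coeff (\<Prod>i<n. [:- of_nat i, 1 :: complex:]) n = 1" by (simp add: *)
qed

text \<open>The coefficient is a divided difference of a monic polynomial of degree
  \<open>n\<close>, so \<open>sum_wt_poly\<close> evaluates it; at \<open>n = card X - 1\<close> the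
  two signs cancel.\<close>

lemma rem_coeff_low:
  assumes "finite X" "X \<noteq> {}" "n \<le> card X - 1"
  shows "rem_coeff X n = (if n = card X - 1 then 1 else 0)"
proof -
  have "card X > 0" using assms by (simp add: card_gt_0_iff)
  hence n: "n < card X" using assms(3) by linarith
  have "dd X (\<lambda>x. ffact x n)
      = (- 1) ^ (card X - 1) * coeff (\<Prod>i<n. [:- of_nat i, 1:]) (card X - 1)"
    unfolding dd_def ffact_eq_poly using n
    by (intro sum_wt_poly) (auto simp: assms degree_ffact_poly)
  moreover have "coeff (\<Prod>i<n. [:- of_nat i, 1:]) (card X - 1) = (if n = card X - 1 then 1 else 0 :: complex)"
    using assms(3) lead_coeff_ffact_poly[of n] by (auto simp: coeff_eq_0 degree_ffact_poly)
  ultimately show ?thesis by (auto simp: rem_coeff_def simp flip: power_mult_distrib)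
qed

lemma power_series_tendsto_coeff:
  fixes a :: "nat \<Rightarrow> complex"
  assumes "\<And>t. norm t < 1 \<Longrightarrow> (\<lambda>n. a n * t ^ n) sums f t" "\<And>n. n < N \<Longrightarrow> a n = 0"
  shows "((\<lambda>t. f t / t ^ N) \<longlongrightarrow> a N) (at 0)"
proof -
  have "((\<lambda>t. f t / t ^ N) \<longlongrightarrow> (\<lambda>n. a (n + N)) 0) (at 0)"
  proof (rule powser_limit_0_strong[of 1])
    fix t :: complex assume t: "t \<noteq> 0" "norm t < 1"
    have "(\<lambda>n. a (n + N) * t ^ (n + N)) sums (f t - (\<Sum>i<N. a i * t ^ i))"
      using assms(1)[OF t(2)] by (rule sums_split_initial_segment)
    moreover have "(\<Sum>i<N. a i * t ^ i) = 0" using assms(2) by (intro sum.neutral) auto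
    ultimately have "(\<lambda>n. a (n + N) * t ^ (n + N) / t ^ N) sums (f t / t ^ N)"
      by (intro sums_divide) simp
    thus "(\<lambda>n. a (n + N) * t ^ n) sums (f t / t ^ N)" using t by (simp add: power_add)
  qed auto
  thus ?thesis by simp
qed


section \<open>Existence and uniqueness of the approximants\<close>

text \<open>Once the coefficients below \<open>n\<close> are known to vanish,
  \<open>f t / t ^ n\<close> tends to \<open>a n\<close>; but it is also \<open>f t / t ^ N\<close>
  times \<open>t ^ (N - n)\<close>, which tends to \<open>0\<close>.\<close>

lemma power_series_coeffs_vanish:
  fixes a :: "nat \<Rightarrow> complex"
  assumes "\<And>t. norm t < 1 \<Longrightarrow> (\<lambda>n. a n * t ^ n) sums f t"
    and lim: "((\<lambda>t. f t / t ^ N) \<longlongrightarrow> 0) (at 0)"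
  shows "n \<le> N \<Longrightarrow> a n = 0"
proof (induction n rule: less_induct)
  case (less n)
  have "((\<lambda>t. f t / t ^ n) \<longlongrightarrow> a n) (at 0)"
    using assms(1) less by (intro power_series_tendsto_coeff) auto
  \<comment> \<open>At \<open>n = N\<close> the factor \<open>0 ^ (N - n)\<close> is
    \<open>1\<close>, and the limit is still \<open>0\<close>.\<close>
  moreover have "((\<lambda>t. f t / t ^ N * t ^ (N - n)) \<longlongrightarrow> 0 * 0 ^ (N - n)) (at 0)"
    by (intro tendsto_intros lim)
  hence "((\<lambda>t. f t / t ^ n) \<longlongrightarrow> 0) (at 0)"
  proof (subst (asm) tendsto_cong)
    show "\<forall>\<^sub>F t in at 0. f t / t ^ N * t ^ (N - n) = f t / t ^ n"
      using eventually_neq_at_within[of 0]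
      by eventually_elim (use less.prems in \<open>auto simp: power_diff\<close>)
  qed simp
  ultimately show ?case using tendsto_unique[OF trivial_limit_at] by blast
qed

text \<open>Powers are combinations of falling factorials of no larger degree, so all moments of
  degree below \<open>card A\<close> vanish. A polynomial vanishing at every \<open>x q\<close>
  except \<open>x p\<close> then isolates \<open>a p\<close>.\<close>

lemma ffact_moments_imp_zero:
  assumes "finite A" "inj_on x A" "p \<in> A"
    and "\<And>n. n < card A \<Longrightarrow> (\<Sum>q\<in>A. a q * ffact (x q) n) = 0"
  shows "a p = 0"
proof -
  \<comment> \<open>Mixed moments make the induction close:
    \<open>y * ffact y n = ffact y (Suc n) + n * ffact y n\<close> trades one power for one falling
    factor, so the total degree does not grow.\<close>
  have mom: "(\<Sum>q\<in>A. a q * (x q ^ j * ffact (x q) n)) = 0" if "j + n < card A" for j n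
    using that
  proof (induction j arbitrary: n)
    case (Suc j)
    have "x q ^ Suc j * ffact (x q) n = x q ^ j * ffact (x q) (Suc n) + of_nat n * (x q ^ j * ffact (x q) n)" for q
      by (simp add: ffact_def algebra_simps)
    hence "(\<Sum>q\<in>A. a q * (x q ^ Suc j * ffact (x q) n))
        = (\<Sum>q\<in>A. a q * (x q ^ j * ffact (x q) (Suc n))) + of_nat n * (\<Sum>q\<in>A. a q * (x q ^ j * ffact (x q) n))"
      by (simp add: sum_distrib_left sum.distrib algebra_simps)
    thus ?case using Suc by simp
  qed (use assms in auto)
  define Q where "Q = (\<Prod>q\<in>A - {p}. [:- x q, 1:])"
  have "degree Q = card A - 1"
    unfolding Q_def using assms by (subst degree_prod_sum_eq) auto
  moreover have "card A > 0" using assms by (auto simp: card_gt_0_iff)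
  ultimately have deg: "degree Q < card A" by simp
  have "(\<Sum>q\<in>A. a q * poly Q (x q)) = (\<Sum>q\<in>A. \<Sum>j\<le>degree Q. coeff Q j * (a q * (x q ^ j * ffact (x q) 0)))"
    by (simp add: poly_altdef sum_distrib_left ffact_def mult_ac)
  also have "\<dots> = (\<Sum>j\<le>degree Q. coeff Q j * (\<Sum>q\<in>A. a q * (x q ^ j * ffact (x q) 0)))"
    by (subst sum.swap) (simp add: sum_distrib_left)
  also have "\<dots> = 0" using deg by (intro sum.neutral) (auto simp: mom)
  also have "(\<Sum>q\<in>A. a q * poly Q (x q)) = (\<Sum>q\<in>A. if q = p then a p * poly Q (x p) else 0)"
    using assms by (intro sum.cong) (auto simp: Q_def poly_prod)
  also have "\<dots> = a p * poly Q (x p)" using assms by simp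
  finally show ?thesis using assms by (auto simp: Q_def poly_prod inj_on_def)
qed

text \<open>Powers of \<open>1 - z\<close> are the suitable basis here: \<open>(1 - z)^r\<close>
  merges with \<open>(1 - z)^\<omega>\<close> into the power at a single node
  \<open>\<omega> + r\<close>.\<close>

lemma poly_one_minus:
  fixes p :: "complex poly"
  assumes "degree p \<le> n"
  shows "poly p z = (\<Sum>r\<le>n. coeff (pcompose p [:1, -1:]) r * (1 - z) ^ r)"
proof -
  have "degree (pcompose p [:1, -1:]) \<le> n" using assms by (simp add: degree_pcompose)
  hence "poly (pcompose p [:1, -1:]) (1 - z) = (\<Sum>r\<le>n. coeff (pcompose p [:1, -1:]) r * (1 - z) ^ r)"
    unfolding poly_altdef by (intro sum.mono_neutral_left) (auto simp: coeff_eq_0)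
  thus ?thesis by (simp add: poly_pcompose)
qed

lemma pade_form_expand:
  assumes "\<And>m. m \<le> M \<Longrightarrow> degree (H m) \<le> \<rho> m" "z \<noteq> 1"
  shows "pade_form M \<omega> H z = (\<Sum>(m, r)\<in>(SIGMA m:{..M}. {..\<rho> m}).
    coeff (pcompose (H m) [:1, -1:]) r * (1 - z) powr (\<omega> m + of_nat r))"
proof -
  have "pade_form M \<omega> H z = (\<Sum>m\<le>M. \<Sum>r\<le>\<rho> m.
    coeff (pcompose (H m) [:1, -1:]) r * (1 - z) powr (\<omega> m + of_nat r))"
    unfolding pade_form_def
  proof (rule sum.cong[OF refl])
    fix m assume "m \<in> {..M}"
    hence "poly (H m) z = (\<Sum>r\<le>\<rho> m. coeff (pcompose (H m) [:1, -1:]) r * (1 - z) ^ r)"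
      using assms by (intro poly_one_minus) auto
    thus "poly (H m) z * (1 - z) powr \<omega> m = (\<Sum>r\<le>\<rho> m.
      coeff (pcompose (H m) [:1, -1:]) r * (1 - z) powr (\<omega> m + of_nat r))"
      using assms(2) by (simp add: sum_distrib_left sum_distrib_right powr_add powr_nat' mult_ac)
  qed
  thus ?thesis by (simp add: sum.Sigma)
qed

lemma is_pade_unique:
  assumes "noncongruent \<omega> {..M}" "is_pade M \<omega> \<rho> H" "is_pade M \<omega> \<rho> K"
  shows "H = K"
proof
  fix m
  define A where "A = (SIGMA m:{..M}. {..\<rho> m})"
  define x where "x = (\<lambda>(m, r). \<omega> m + complex_of_nat r)"
  define a where "a = (\<lambda>(m, r). coeff (pcompose (H m) [:1, -1:]) r - coeff (pcompose (K m) [:1, -1:]) r)"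
  have cardA: "card A = vec_size M \<rho>" by (simp add: A_def vec_size_def)
  have vs: "vec_size M \<rho> > 0" by (simp add: vec_size_def sum.atMost_shift)
  have inj: "inj_on x A"
  proof (rule inj_onI)
    fix p q assume pq: "p \<in> A" "q \<in> A" "x p = x q"
    obtain m r n s where eq: "p = (m, r)" "q = (n, s)" by (cases p, cases q) auto
    show "p = q"
    proof (cases "m = n")
      case False
      hence "node_block (\<omega> m) (\<rho> m) \<inter> node_block (\<omega> n) (\<rho> n) = {}"
        using assms(1) pq by (intro node_block_disjoint) (auto simp: noncongruent_def A_def eq)
      moreover have "x p \<in> node_block (\<omega> m) (\<rho> m)"
        using pq(1) by (auto simp: x_def eq A_def node_block_def)
      moreover have "x q \<in> node_block (\<omega> n) (\<rho> n)"
        using pq(2) by (auto simp: x_def eq A_def node_block_def)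
      ultimately show ?thesis using pq by auto
    qed (use pq in \<open>auto simp: x_def eq\<close>)
  qed
  define c where "c = (\<lambda>n. (- 1) ^ n * (\<Sum>p\<in>A. a p * ffact (x p) n))"
  have "(\<lambda>n. c n / fact n * t ^ n) sums (pade_form M \<omega> H t - pade_form M \<omega> K t)" if "norm t < 1" for t
  proof -
    have "t \<noteq> 1" using that by auto
    moreover have deg: "\<And>m. m \<le> M \<Longrightarrow> degree (H m) \<le> \<rho> m" "\<And>m. m \<le> M \<Longrightarrow> degree (K m) \<le> \<rho> m"
      using assms by (auto simp: is_pade_def)
    ultimately have "pade_form M \<omega> H t - pade_form M \<omega> K t = (\<Sum>p\<in>A. a p * (1 - t) powr x p)"
      using deg pade_form_expand[where \<rho> = \<rho> and z = t and M = M and H = H and \<omega> = \<omega>] pade_form_expand[where \<rho> = \<rho> and z = t and M = M and H = K and \<omega> = \<omega>]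
      by (simp add: a_def x_def A_def case_prod_unfold left_diff_distrib sum_subtractf)
    thus ?thesis using sum_powr_sums[OF that, where A = A and a = a and x = x] by (simp add: c_def mult_ac)
  qed
  \<comment> \<open>Both forms have the same normalised limit, so the difference also loses its
    coefficient of degree \<open>\<sigma> - 1\<close>. This supplies the last of the
    \<open>\<sigma>\<close> vanishing moments.\<close>
  moreover have "((\<lambda>t. (pade_form M \<omega> H t - pade_form M \<omega> K t) / t ^ (vec_size M \<rho> - 1)) \<longlongrightarrow> 0) (at 0)"
  proof -
    have "((\<lambda>t. pade_form M \<omega> H t / t ^ (vec_size M \<rho> - 1) - pade_form M \<omega> K t / t ^ (vec_size M \<rho> - 1))
      \<longlongrightarrow> 1 / fact (vec_size M \<rho> - 1) - 1 / fact (vec_size M \<rho> - 1)) (at 0)"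
      using assms(2,3) unfolding is_pade_def by (intro tendsto_diff) auto
    thus ?thesis by (simp add: diff_divide_distrib)
  qed
  ultimately have c0: "c n / fact n = 0" if "n \<le> vec_size M \<rho> - 1" for n
    using that by (rule power_series_coeffs_vanish)
  have mom: "(\<Sum>q\<in>A. a q * ffact (x q) n) = 0" if "n < card A" for n
    using c0[of n] that cardA by (simp add: c_def)
  have a0: "a p = 0" if "p \<in> A" for p
    using ffact_moments_imp_zero[OF _ inj that mom] by (simp add: A_def)
  show "H m = K m"
  proof (cases "m \<le> M")
    case True
    have "poly (H m) z = poly (K m) z" for z
    proof -
      have "degree (H m) \<le> \<rho> m" "degree (K m) \<le> \<rho> m" using assms True by (auto simp: is_pade_def)
      moreover have "coeff (pcompose (H m) [:1, -1:]) r = coeff (pcompose (K m) [:1, -1:]) r" if "r \<le> \<rho> m" for r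
        using a0[of "(m, r)"] True that by (simp add: A_def a_def)
      ultimately show ?thesis by (simp add: poly_one_minus[of _ "\<rho> m"])
    qed
    thus ?thesis by (intro poly_eqI_degree[of "UNIV"] poly_ext) auto
  qed (use assms in \<open>auto simp: is_pade_def\<close>)
qed

lemma is_pade_exists:
  assumes "noncongruent \<omega> {..M}"
  obtains H where "is_pade M \<omega> \<rho> H"
    and "\<And>z. z \<noteq> 1 \<Longrightarrow> pade_form M \<omega> H z = rem (node_set \<omega> \<rho> {..M}) z"
proof -
  define X where "X = node_set \<omega> \<rho> {..M}"
  \<comment> \<open>The terms of \<open>rem X\<close> at the nodes \<open>\<omega> m + r\<close>
    with the same \<open>m\<close> are collected into one polynomial in
    \<open>1 - z\<close>.\<close>
  define H where "H = (\<lambda>m. if m \<le> M then \<Sum>r\<le>\<rho> m. smult (wt X (\<omega> m + of_nat r)) ([:1, -1:] ^ r) else 0)"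
  have X: "finite X" "X \<noteq> {}" "card X = vec_size M \<rho>"
    using card_node_set[of "{..M}"] assms by (auto simp: X_def vec_size_def)
  have eq: "pade_form M \<omega> H z = rem X z" if "z \<noteq> 1" for z
    unfolding rem_def dd_def X_def sum_node_set[OF finite_atMost assms] pade_form_def
    using that by (intro sum.cong)
      (auto simp: H_def X_def poly_sum sum_distrib_left sum_distrib_right powr_add powr_nat' mult_ac)
  have sums: "(\<lambda>n. rem_coeff X n * (t ^ n / fact n)) sums pade_form M \<omega> H t" if "norm t < 1" for t
  proof -
    have "t \<noteq> 1" using that by auto
    thus ?thesis using rem_sums[OF that, of X] eq[of t] by simp
  qed
  have "zorder (pade_form M \<omega> H) 0 = int (card X - 1)"
  proof (rule zorder_zero_eqI)
    show "pade_form M \<omega> H holomorphic_on ball 0 1"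
      unfolding pade_form_def
      by (intro holomorphic_intros) (auto simp: unit_disc_slit_plane simp flip: slit_plane_iff)
    fix i assume "i < nat (int (card X - 1))"
    thus "(deriv ^^ i) (pade_form M \<omega> H) 0 = 0"
      using rem_coeff_low[OF X(1,2), of i] by (simp add: higher_deriv_of_sums[OF sums])
  next
    show "(deriv ^^ nat (int (card X - 1))) (pade_form M \<omega> H) 0 \<noteq> 0"
      using rem_coeff_low[OF X(1,2), of "card X - 1"] by (simp add: higher_deriv_of_sums[OF sums])
  qed auto
  moreover have "((\<lambda>z. pade_form M \<omega> H z / z ^ (card X - 1)) \<longlongrightarrow> rem_coeff X (card X - 1) / fact (card X - 1)) (at 0)"
  proof (rule power_series_tendsto_coeff)
    show "(\<lambda>n. rem_coeff X n / fact n * t ^ n) sums pade_form M \<omega> H t" if "norm t < 1" for t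
      using sums[OF that] by (simp add: mult_ac)
  qed (use rem_coeff_low[OF X(1,2)] in auto)
  moreover have "degree (H m) \<le> \<rho> m" if "m \<le> M" for m
  proof -
    have "degree ([:1, -1 :: complex:] ^ r) \<le> r" for r
      using degree_power_le[of "[:1, -1 :: complex:]" r] by simp
    thus ?thesis using that unfolding H_def
      by (auto intro!: degree_sum_le intro: order.trans[OF degree_smult_le] order.trans)
  qed
  ultimately have "is_pade M \<omega> \<rho> H"
    using rem_coeff_low[OF X(1,2), of "card X - 1"] X(3) by (simp add: is_pade_def H_def)
  thus ?thesis using eq that unfolding X_def by blast
qed

lemma Pade_Rem_eq_rem:
  assumes "noncongruent \<omega> {..M}" "z \<noteq> 1"
  shows "Pade_Rem M \<omega> \<rho> z = rem (node_set \<omega> \<rho> {..M}) z"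
proof -
  obtain H where H: "is_pade M \<omega> \<rho> H"
    "\<And>z. z \<noteq> 1 \<Longrightarrow> pade_form M \<omega> H z = rem (node_set \<omega> \<rho> {..M}) z"
    using is_pade_exists[OF assms(1)] by blast
  have "Pade_Poly M \<omega> \<rho> = H"
    unfolding Pade_Poly_def using H(1) is_pade_unique[OF assms(1)] by blast
  thus ?thesis using H(2) assms(2) by (simp add: Pade_Rem_def)
qed


section \<open>Integral recurrence for the remainder\<close>

text \<open>If \<open>u t\<close> lies on the slit with \<open>0 \<le> u \<le> 1\<close>, then so
  does \<open>t\<close>, because \<open>Re t \<ge> u Re t \<ge> 1\<close>. This star shape about
  \<open>0\<close> keeps every segment of integration in the domain of the principal branch.\<close>

lemma closed_segment_slit_plane:
  assumes "t \<in> slit_plane" "s \<in> closed_segment 0 t"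
  shows "s \<in> slit_plane"
proof (rule ccontr)
  obtain u where u: "0 \<le> u" "u \<le> 1" "s = u *\<^sub>R t" using assms(2) by (auto simp: in_segment)
  assume "s \<notin> slit_plane"
  hence *: "u * Re t \<ge> 1" "u * Im t = 0"
    by (auto simp: slit_plane_iff complex_nonpos_Reals_iff u(3))
  hence "u > 0" using u(1) by (cases "u = 0") auto
  have "u * Re t > 0" using *(1) by linarith
  hence "Re t > 0" using \<open>u > 0\<close> zero_less_mult_pos by blast
  hence "u * Re t \<le> Re t" using u by (simp add: mult_left_le_one_le)
  thus False using \<open>u > 0\<close> * assms(1) by (auto simp: slit_plane_iff complex_nonpos_Reals_iff)
qed

lemma has_contour_integral_powr_one_minus:
  assumes "t \<in> slit_plane" "c \<noteq> 0"
  shows "((\<lambda>s. (1 - s) powr (c - 1)) has_contour_integral (1 - (1 - t) powr c) / c) (linepath 0 t)"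
proof -
  have "((\<lambda>s. (1 - s) powr (c - 1)) has_contour_integral
      - ((1 - pathfinish (linepath 0 t)) powr c / c) - - ((1 - pathstart (linepath 0 t)) powr c / c)) (linepath 0 t)"
  proof (rule contour_integral_primitive[where S = slit_plane])
    fix s assume "s \<in> slit_plane"
    hence "1 - s \<notin> \<real>\<^sub>\<le>\<^sub>0" by (simp add: slit_plane_iff)
    thus "((\<lambda>s. - ((1 - s) powr c / c)) has_field_derivative (1 - s) powr (c - 1)) (at s within slit_plane)"
      using assms(2) by (auto intro!: derivative_eq_intros)
  next
    show "path_image (linepath 0 t) \<subseteq> slit_plane"
      unfolding path_image_linepath using closed_segment_slit_plane[OF assms(1)] by blast
  qed (rule valid_path_linepath)
  thus ?thesis by (simp add: diff_divide_distrib)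
qed

text \<open>For single nodes the integral of \<open>(1 - t)^y (1 - s)^(x - y - 1)\<close> is
  \<open>((1 - t)^y - (1 - t)^x) / (x - y)\<close>. Summed with weights, the two terms separate; in
  each the inner sum over the other set is a partial fraction expansion, which converts a weight of
  \<open>X\<close> or \<open>Y\<close> into a weight of \<open>X \<union> Y\<close>.\<close>

lemma has_contour_integral_rem_Un:
  assumes "finite X" "X \<noteq> {}" "finite Y" "Y \<noteq> {}" "X \<inter> Y = {}" "t \<in> slit_plane"
  shows "((\<lambda>s. dd Y (\<lambda>y. (1 - t) powr y * (1 - s) powr (- y - 1)) * rem X s)
    has_contour_integral rem (X \<union> Y) t) (linepath 0 t)"
proof -
  let ?w = "\<lambda>x y. wt X x * wt Y y * (1 - t) powr y"
  have ne: "x \<noteq> y" if "x \<in> X" "y \<in> Y" for x y using that assms(5) by auto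
  have nz: "1 - s \<noteq> 0" if "s \<in> slit_plane" for s using that by (auto simp: slit_plane_iff)
  have "((\<lambda>s. \<Sum>y\<in>Y. \<Sum>x\<in>X. ?w x y * (1 - s) powr (x - y - 1)) has_contour_integral
      (\<Sum>y\<in>Y. \<Sum>x\<in>X. ?w x y * ((1 - (1 - t) powr (x - y)) / (x - y)))) (linepath 0 t)"
    by (intro has_contour_integral_sum has_contour_integral_lmul has_contour_integral_powr_one_minus assms)
       (use ne in auto)
  also have "(\<Sum>y\<in>Y. \<Sum>x\<in>X. ?w x y * ((1 - (1 - t) powr (x - y)) / (x - y)))
      = (\<Sum>y\<in>Y. \<Sum>x\<in>X. wt X x * wt Y y * (((1 - t) powr y - (1 - t) powr x) / (x - y)))"
    by (intro sum.cong refl) (simp add: powr_diff nz[OF assms(6)] algebra_simps)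
  also have "\<dots> = (\<Sum>y\<in>Y. wt Y y * (1 - t) powr y * (\<Sum>x\<in>X. wt X x / (x - y)))
      + (\<Sum>x\<in>X. wt X x * (1 - t) powr x * (\<Sum>y\<in>Y. wt Y y / (y - x)))"
  proof -
    have "wt X x * wt Y y * (((1 - t) powr y - (1 - t) powr x) / (x - y))
        = wt Y y * (1 - t) powr y * (wt X x / (x - y)) + wt X x * (1 - t) powr x * (wt Y y / (y - x))"
      if "x \<in> X" "y \<in> Y" for x y
    proof -
      have "wt Y y / (y - x) = - (wt Y y / (x - y))"
        by (metis minus_diff_eq divide_minus_right)
      thus ?thesis by (simp add: diff_divide_distrib algebra_simps)
    qed
    hence "(\<Sum>y\<in>Y. \<Sum>x\<in>X. wt X x * wt Y y * (((1 - t) powr y - (1 - t) powr x) / (x - y)))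
      = (\<Sum>y\<in>Y. \<Sum>x\<in>X. wt Y y * (1 - t) powr y * (wt X x / (x - y)))
      + (\<Sum>y\<in>Y. \<Sum>x\<in>X. wt X x * (1 - t) powr x * (wt Y y / (y - x)))"
      by (simp add: sum.distrib)
    also have "(\<Sum>y\<in>Y. \<Sum>x\<in>X. wt X x * (1 - t) powr x * (wt Y y / (y - x)))
      = (\<Sum>x\<in>X. \<Sum>y\<in>Y. wt X x * (1 - t) powr x * (wt Y y / (y - x)))"
      by (rule sum.swap)
    finally show ?thesis by (simp add: sum_distrib_left)
  qed
  also have "(\<Sum>y\<in>Y. wt Y y * (1 - t) powr y * (\<Sum>x\<in>X. wt X x / (x - y)))
      = (\<Sum>y\<in>Y. wt (X \<union> Y) y * (1 - t) powr y)"
    using assms by (intro sum.cong refl)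
      (subst partial_fractions[symmetric], auto simp: wt_Un[of Y X] Un_commute[of X] Int_commute)
  also have "(\<Sum>x\<in>X. wt X x * (1 - t) powr x * (\<Sum>y\<in>Y. wt Y y / (y - x)))
      = (\<Sum>x\<in>X. wt (X \<union> Y) x * (1 - t) powr x)"
    using assms by (intro sum.cong refl) (subst partial_fractions[symmetric], auto simp: wt_Un)
  also have "(\<Sum>y\<in>Y. wt (X \<union> Y) y * (1 - t) powr y) + (\<Sum>x\<in>X. wt (X \<union> Y) x * (1 - t) powr x) = rem (X \<union> Y) t"
    using assms by (simp add: rem_def dd_def sum.union_disjoint add.commute)
  finally show ?thesis
  proof (rule has_contour_integral_eq)
    fix s assume "s \<in> path_image (linepath 0 t)"
    hence s: "1 - s \<noteq> 0" using closed_segment_slit_plane[OF assms(6)] nz by auto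
    show "(\<Sum>y\<in>Y. \<Sum>x\<in>X. ?w x y * (1 - s) powr (x - y - 1)) =
      dd Y (\<lambda>y. (1 - t) powr y * (1 - s) powr (- y - 1)) * rem X s"
      unfolding dd_def rem_def sum_product
    proof (intro sum.cong refl)
      fix x y
      have "(1 - s) powr (x - y - 1) = (1 - s) powr (- y - 1) * (1 - s) powr x"
        unfolding powr_add[symmetric] by (simp add: algebra_simps)
      thus "?w x y * (1 - s) powr (x - y - 1) =
          wt Y y * ((1 - t) powr y * (1 - s) powr (- y - 1)) * (wt X x * (1 - s) powr x)"
        by simp
    qed
  qed
qed

text \<open>Moving from one node of the block to the next multiplies the powers by
  \<open>q = (1 - t) / (1 - s)\<close>, so the binomial weights sum to a multiple of
  \<open>(1 - q)^n\<close>, where \<open>1 - q = (t - s) / (1 - s)\<close>.\<close>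

lemma dd_node_block_kernel:
  assumes "s \<noteq> 1" "t \<noteq> 1"
  shows "dd (node_block w n) (\<lambda>y. (1 - t) powr y * (1 - s) powr (- y - 1)) =
    (1 - t) powr w * (1 - s) powr (- w - 1) * ((t - s) / (1 - s)) ^ n / fact n"
proof -
  define q where "q = (1 - t) / (1 - s)"
  have "dd (node_block w n) (\<lambda>y. (1 - t) powr y * (1 - s) powr (- y - 1))
      = (\<Sum>i\<le>n. (1 - t) powr w * (1 - s) powr (- w - 1) / fact n * (of_nat (n choose i) * (- q) ^ i * 1 ^ (n - i)))"
    unfolding dd_def sum_node_block
  proof (rule sum.cong[OF refl])
    fix i assume "i \<in> {..n}"
    have "(1 - s) powr (- (w + of_nat i) - 1) = (1 - s) powr (- w - 1 - of_nat i)"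
      by (simp add: algebra_simps)
    also have "\<dots> = (1 - s) powr (- w - 1) / (1 - s) ^ i"
      using assms by (simp add: powr_diff[of _ "- w - 1"] powr_nat')
    finally have "(1 - t) powr (w + of_nat i) * (1 - s) powr (- (w + of_nat i) - 1)
        = (1 - t) powr w * (1 - s) powr (- w - 1) * q ^ i"
      using assms by (simp add: powr_add powr_nat' q_def power_divide)
    thus "wt (node_block w n) (w + of_nat i) * ((1 - t) powr (w + of_nat i) * (1 - s) powr (- (w + of_nat i) - 1))
        = (1 - t) powr w * (1 - s) powr (- w - 1) / fact n * (of_nat (n choose i) * (- q) ^ i * 1 ^ (n - i))"
      using \<open>i \<in> {..n}\<close> by (simp add: wt_node_block power_minus[of q])
  qed
  also have "\<dots> = (1 - t) powr w * (1 - s) powr (- w - 1) / fact n * (1 - q) ^ n"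
    unfolding sum_distrib_left[symmetric] using binomial_ring[of "- q" 1 n] by simp
  also have "1 - q = (t - s) / (1 - s)" using assms by (simp add: q_def field_simps)
  finally show ?thesis by simp
qed

text \<open>
  The value of the integrals over \<open>t\<^bsub>k+1\<^esub>, \<dots>, t\<^bsub>M\<^esub>\<close>, as a function of \<open>s = t\<^bsub>k\<^esub>\<close>, once
  the factors depending only on \<open>t\<^bsub>0\<^esub>, \<dots>, t\<^bsub>k\<^esub>\<close> are split off.
\<close>

definition tail_rem :: "nat \<Rightarrow> (nat \<Rightarrow> complex) \<Rightarrow> (nat \<Rightarrow> nat) \<Rightarrow> nat \<Rightarrow> complex \<Rightarrow> complex" where
  "tail_rem M \<omega> \<rho> k s =
     (\<Prod>m=k..M. fact (\<rho> m)) * (1 - s) powr (- \<omega> k) * rem (node_set \<omega> \<rho> {k..M}) s"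

text \<open>At \<open>s = 0\<close> the kernel formula sums the divided difference of the single
  block of \<open>\<omega> M\<close>.\<close>

lemma tail_rem_last:
  assumes "t \<in> slit_plane"
  shows "tail_rem M \<omega> \<rho> M t = t ^ \<rho> M"
proof -
  have t: "t \<noteq> 1" using assms by (auto simp: slit_plane_iff)
  have "rem (node_set \<omega> \<rho> {M..M}) t = (1 - t) powr \<omega> M * t ^ \<rho> M / fact (\<rho> M)"
    using dd_node_block_kernel[of 0 t "\<omega> M" "\<rho> M"] t by (simp add: rem_def node_set_def)
  thus ?thesis using t by (simp add: tail_rem_def powr_minus)
qed

text \<open>The convolution \<open>has_contour_integral_rem_Un\<close> with \<open>Y\<close> the
  block of \<open>\<omega> k\<close> and \<open>X\<close> the nodes of larger index. The normalising
  powers in \<open>tail_rem\<close> cancel \<open>(1 - t)^(\<omega> k)\<close> from the kernel and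
  leave the exponent \<open>\<omega> (Suc k) - \<omega> k - 1\<close> on
  \<open>1 - s\<close>.\<close>

lemma tail_rem_recurrence:
  assumes "noncongruent \<omega> {..M}" "k < M" "t \<in> slit_plane"
  shows "((\<lambda>s. ((t - s) / (1 - s)) ^ \<rho> k * (1 - s) powr (\<omega> (Suc k) - \<omega> k - 1) * tail_rem M \<omega> \<rho> (Suc k) s)
    has_contour_integral tail_rem M \<omega> \<rho> k t) (linepath 0 t)"
proof -
  define X where "X = node_set \<omega> \<rho> {Suc k..M}"
  define F where "F = (\<Prod>m=Suc k..M. fact (\<rho> m) :: complex)"
  have t: "t \<noteq> 1" using assms(3) by (auto simp: slit_plane_iff)
  have ins: "{k..M} = insert k {Suc k..M}" using assms(2) by auto
  have "noncongruent \<omega> (insert k {Suc k..M})"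
    unfolding ins[symmetric] using assms(1) by (rule noncongruent_subset) auto
  hence disj: "X \<inter> node_block (\<omega> k) (\<rho> k) = {}"
    using node_block_set_disjoint[of \<omega> k "{Suc k..M}" \<rho>] by (auto simp: X_def)
  have un: "X \<union> node_block (\<omega> k) (\<rho> k) = node_set \<omega> \<rho> {k..M}"
    by (auto simp: X_def node_set_def ins)
  have F: "(\<Prod>m=k..M. fact (\<rho> m)) = fact (\<rho> k) * F" by (simp add: F_def ins)
  have "((\<lambda>s. fact (\<rho> k) * F * (1 - t) powr (- \<omega> k) *
      (dd (node_block (\<omega> k) (\<rho> k)) (\<lambda>y. (1 - t) powr y * (1 - s) powr (- y - 1)) * rem X s))
      has_contour_integral fact (\<rho> k) * F * (1 - t) powr (- \<omega> k) * rem (X \<union> node_block (\<omega> k) (\<rho> k)) t)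
      (linepath 0 t)"
    using assms(2,3) disj
    by (intro has_contour_integral_lmul has_contour_integral_rem_Un) (auto simp: X_def)
  hence "((\<lambda>s. fact (\<rho> k) * F * (1 - t) powr (- \<omega> k) *
      (dd (node_block (\<omega> k) (\<rho> k)) (\<lambda>y. (1 - t) powr y * (1 - s) powr (- y - 1)) * rem X s))
      has_contour_integral tail_rem M \<omega> \<rho> k t) (linepath 0 t)"
    by (simp add: tail_rem_def un F)
  thus ?thesis
  proof (rule has_contour_integral_eq)
    fix s assume "s \<in> path_image (linepath 0 t)"
    hence s: "s \<noteq> 1" using closed_segment_slit_plane[OF assms(3), of s] by (auto simp: slit_plane_iff)
    have "(1 - s) powr (- \<omega> k - 1) = (1 - s) powr (\<omega> (Suc k) - \<omega> k - 1) * (1 - s) powr (- \<omega> (Suc k))"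
      by (simp flip: powr_add)
    moreover have "(1 - t) powr (- \<omega> k) * (1 - t) powr (\<omega> k) = 1" using t by (simp flip: powr_add)
    ultimately show "fact (\<rho> k) * F * (1 - t) powr (- \<omega> k) *
      (dd (node_block (\<omega> k) (\<rho> k)) (\<lambda>y. (1 - t) powr y * (1 - s) powr (- y - 1)) * rem X s)
      = ((t - s) / (1 - s)) ^ \<rho> k * (1 - s) powr (\<omega> (Suc k) - \<omega> k - 1) * tail_rem M \<omega> \<rho> (Suc k) s"
      by (simp add: dd_node_block_kernel[OF s t] tail_rem_def F_def[symmetric] X_def[symmetric])
  qed
qed

section \<open>Evaluation of the iterated integral\<close>

definition head_factor :: "(nat \<Rightarrow> complex) \<Rightarrow> (nat \<Rightarrow> nat) \<Rightarrow> nat \<Rightarrow> (nat \<Rightarrow> complex) \<Rightarrow> complex" where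
  "head_factor \<omega> \<rho> k t =
     (\<Prod>h=1..k. ((t (h - 1) - t h) / (1 - t h)) ^ \<rho> (h - 1)) *
     (\<Prod>h=1..k. (1 - t h) powr (\<omega> h - \<omega> (h - 1) - 1))"

lemma head_factor_Suc:
  "head_factor \<omega> \<rho> (Suc k) t = head_factor \<omega> \<rho> k t *
     (((t k - t (Suc k)) / (1 - t (Suc k))) ^ \<rho> k * (1 - t (Suc k)) powr (\<omega> (Suc k) - \<omega> k - 1))"
  by (simp add: head_factor_def)

lemma head_factor_cong: "(\<And>h. h \<le> k \<Longrightarrow> t h = t' h) \<Longrightarrow> head_factor \<omega> \<rho> k t = head_factor \<omega> \<rho> k t'"
  unfolding head_factor_def by (intro arg_cong2[of _ _ _ _ "(*)"] prod.cong) auto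

text \<open>Induction from the innermost integral outwards: the head factor up to \<open>k\<close>
  is constant in the new variable, and the factor added by \<open>head_factor_Suc\<close> is the
  kernel of \<open>tail_rem_recurrence\<close>. Integrability is carried along, since the inner
  integral has a known value on the whole segment.\<close>

lemma iter_integral_segment_integrand:
  assumes "noncongruent \<omega> {..M}" "k + d = M" "t k \<in> slit_plane"
  shows "iter_integrable (segment_integrand M \<omega> \<rho>) k d t \<and>
    iter_integral (segment_integrand M \<omega> \<rho>) k d t = head_factor \<omega> \<rho> k t * tail_rem M \<omega> \<rho> k (t k)"
  using assms(2,3)
proof (induction d arbitrary: k t)
  case 0
  thus ?case by (simp add: segment_integrand_def head_factor_def tail_rem_last mult_ac)
next
  case (Suc d)
  let ?g = "\<lambda>s. iter_integral (segment_integrand M \<omega> \<rho>) (Suc k) d (t(Suc k := s))"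
  have IH: "iter_integrable (segment_integrand M \<omega> \<rho>) (Suc k) d (t(Suc k := s))"
    "?g s = head_factor \<omega> \<rho> k t *
      (((t k - s) / (1 - s)) ^ \<rho> k * (1 - s) powr (\<omega> (Suc k) - \<omega> k - 1) * tail_rem M \<omega> \<rho> (Suc k) s)"
    if "s \<in> closed_segment 0 (t k)" for s
  proof -
    have 1: "Suc k + d = M" using Suc.prems by simp
    have 2: "(t(Suc k := s)) (Suc k) \<in> slit_plane"
      using closed_segment_slit_plane[OF Suc.prems(2) that] by simp
    have 3: "head_factor \<omega> \<rho> k (t(Suc k := s)) = head_factor \<omega> \<rho> k t"
      by (rule head_factor_cong) simp
    show "iter_integrable (segment_integrand M \<omega> \<rho>) (Suc k) d (t(Suc k := s))"
      using Suc.IH[of "Suc k" "t(Suc k := s)", OF 1 2] by blast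
    have "?g s = head_factor \<omega> \<rho> (Suc k) (t(Suc k := s)) * tail_rem M \<omega> \<rho> (Suc k) ((t(Suc k := s)) (Suc k))"
      using Suc.IH[of "Suc k" "t(Suc k := s)", OF 1 2] by (rule conjunct2)
    thus "?g s = head_factor \<omega> \<rho> k t *
      (((t k - s) / (1 - s)) ^ \<rho> k * (1 - s) powr (\<omega> (Suc k) - \<omega> k - 1) * tail_rem M \<omega> \<rho> (Suc k) s)"
      unfolding head_factor_Suc 3 fun_upd_same by (simp only: fun_upd_other n_not_Suc_n mult.assoc not_False_eq_True)
  qed
  have "((\<lambda>s. head_factor \<omega> \<rho> k t *
      (((t k - s) / (1 - s)) ^ \<rho> k * (1 - s) powr (\<omega> (Suc k) - \<omega> k - 1) * tail_rem M \<omega> \<rho> (Suc k) s))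
      has_contour_integral head_factor \<omega> \<rho> k t * tail_rem M \<omega> \<rho> k (t k)) (linepath 0 (t k))"
    using Suc.prems by (intro has_contour_integral_lmul tail_rem_recurrence assms(1)) auto
  hence "(?g has_contour_integral head_factor \<omega> \<rho> k t * tail_rem M \<omega> \<rho> k (t k)) (linepath 0 (t k))"
    by (rule has_contour_integral_eq) (use IH(2) in auto)
  thus ?case using IH(1)
    by (auto simp: contour_integral_unique contour_integrable_on_def)
qed

lemma rem_eq_iter_integral:
  assumes "noncongruent \<omega> {..M}" "z \<in> slit_plane"
  shows "iter_integrable (segment_integrand M \<omega> \<rho>) 0 M (\<lambda>_. z)"
    and "rem (node_set \<omega> \<rho> {..M}) z =
      (1 - z) powr \<omega> 0 / vec_fact M \<rho> * iter_integral (segment_integrand M \<omega> \<rho>) 0 M (\<lambda>_. z)"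
proof -
  have "z \<noteq> 1" using assms(2) by (auto simp: slit_plane_iff)
  moreover have "vec_fact M \<rho> \<noteq> 0" by (simp add: vec_fact_def)
  ultimately show "rem (node_set \<omega> \<rho> {..M}) z =
      (1 - z) powr \<omega> 0 / vec_fact M \<rho> * iter_integral (segment_integrand M \<omega> \<rho>) 0 M (\<lambda>_. z)"
    using iter_integral_segment_integrand[OF assms(1), of 0 M "\<lambda>_. z" \<rho>] assms(2)
    by (simp add: head_factor_def tail_rem_def vec_fact_def powr_minus atLeast0AtMost)
  show "iter_integrable (segment_integrand M \<omega> \<rho>) 0 M (\<lambda>_. z)"
    using iter_integral_segment_integrand[OF assms(1), of 0 M "\<lambda>_. z" \<rho>] assms(2) by simp
qed


section \<open>The integral over the unit cube\<close>

declare One_nat_def [simp del]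

abbreviation cube_measure :: "nat \<Rightarrow> (nat \<Rightarrow> real) measure" where
  "cube_measure k \<equiv> (\<Pi>\<^sub>M h\<in>{1..k}. lborel)"

abbreviation unit_cube :: "nat \<Rightarrow> (nat \<Rightarrow> real) set" where
  "unit_cube k \<equiv> (\<Pi>\<^sub>E h\<in>{1..k}. {0..1})"

interpretation lborel_product: product_sigma_finite "\<lambda>_::nat. lborel :: real measure"
  by standard

section \<open>Bounded measurable functions on the unit cube\<close>

lemma unit_cube_sets: "unit_cube k \<in> sets (cube_measure k)"
  by (intro sets_PiM_I_finite) auto

lemma emeasure_unit_cube: "emeasure (cube_measure k) (unit_cube k) = 1"
  by (subst lborel_product.emeasure_PiM) auto

text \<open>A criterion for integrability that is stable under the algebra building the integrands.
  Measurability is asked of the function cut off to the cube, because the powers are continuous only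
  while their argument stays in the slit plane.\<close>

definition cube_bounded :: "nat \<Rightarrow> ((nat \<Rightarrow> real) \<Rightarrow> complex) \<Rightarrow> bool" where
  "cube_bounded k f \<longleftrightarrow> (\<lambda>u. indicator (unit_cube k) u *\<^sub>R f u) \<in> borel_measurable (cube_measure k) \<and>
     (\<exists>B. \<forall>u\<in>unit_cube k. norm (f u) \<le> B)"

lemma cube_bounded_set_integrable:
  assumes "cube_bounded k f"
  shows "set_integrable (cube_measure k) (unit_cube k) f"
proof -
  obtain B where B: "\<And>u. u \<in> unit_cube k \<Longrightarrow> norm (f u) \<le> B"
    using assms unfolding cube_bounded_def by blast
  have "integrable (cube_measure k)
    (\<lambda>u. indicator (unit_cube k) u *\<^sub>R (indicator (unit_cube k) u *\<^sub>R f u))"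
    using assms B unit_cube_sets emeasure_unit_cube
    by (intro integrableI_bounded_set_indicator[where B = B]) (auto simp: cube_bounded_def)
  moreover have "(\<lambda>u. indicator (unit_cube k) u *\<^sub>R (indicator (unit_cube k) u *\<^sub>R f u))
    = (\<lambda>u. indicator (unit_cube k) u *\<^sub>R f u)" by (auto simp: indicator_def fun_eq_iff)
  ultimately show ?thesis unfolding set_integrable_def by simp
qed

lemma cube_bounded_mult:
  assumes "cube_bounded k f" "cube_bounded k g"
  shows "cube_bounded k (\<lambda>u. f u * g u)"
proof -
  obtain B C where B: "\<And>u. u \<in> unit_cube k \<Longrightarrow> norm (f u) \<le> B"
    and C: "\<And>u. u \<in> unit_cube k \<Longrightarrow> norm (g u) \<le> C"
    using assms unfolding cube_bounded_def by blast
  have "(\<lambda>u. (indicator (unit_cube k) u *\<^sub>R f u) * (indicator (unit_cube k) u *\<^sub>R g u))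
    \<in> borel_measurable (cube_measure k)"
    using assms by (intro borel_measurable_times) (auto simp: cube_bounded_def)
  also have "(\<lambda>u. (indicator (unit_cube k) u *\<^sub>R f u) * (indicator (unit_cube k) u *\<^sub>R g u))
    = (\<lambda>u. indicator (unit_cube k) u *\<^sub>R (f u * g u))" by (auto simp: indicator_def fun_eq_iff)
  finally have "(\<lambda>u. indicator (unit_cube k) u *\<^sub>R (f u * g u)) \<in> borel_measurable (cube_measure k)" .
  moreover have "norm (f u * g u) \<le> B * C" if "u \<in> unit_cube k" for u
    unfolding norm_mult by (intro mult_mono' B C that norm_ge_zero)
  ultimately show ?thesis unfolding cube_bounded_def by blast
qed

lemma cube_bounded_diff:
  assumes "cube_bounded k f" "cube_bounded k g"
  shows "cube_bounded k (\<lambda>u. f u - g u)"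
proof -
  obtain B C where B: "\<And>u. u \<in> unit_cube k \<Longrightarrow> norm (f u) \<le> B"
    and C: "\<And>u. u \<in> unit_cube k \<Longrightarrow> norm (g u) \<le> C"
    using assms unfolding cube_bounded_def by blast
  have "(\<lambda>u. (indicator (unit_cube k) u *\<^sub>R f u) - (indicator (unit_cube k) u *\<^sub>R g u))
    \<in> borel_measurable (cube_measure k)"
    using assms by (intro borel_measurable_diff) (auto simp: cube_bounded_def)
  moreover have "norm (f u - g u) \<le> B + C" if "u \<in> unit_cube k" for u
    by (rule order.trans[OF norm_triangle_ineq4 add_mono[OF B[OF that] C[OF that]]])
  ultimately show ?thesis unfolding cube_bounded_def scaleR_diff_right by blast
qed

lemma cube_bounded_of_borel:
  assumes "f \<in> borel_measurable (cube_measure k)" "\<And>u. u \<in> unit_cube k \<Longrightarrow> norm (f u) \<le> B"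
  shows "cube_bounded k f"
  unfolding cube_bounded_def
  using assms unit_cube_sets by (auto intro!: borel_measurable_scaleR borel_measurable_indicator)

lemma cube_bounded_const: "cube_bounded k (\<lambda>_. c)"
  by (rule cube_bounded_of_borel[where B = "norm c"]) auto

lemma cube_bounded_power: "cube_bounded k f \<Longrightarrow> cube_bounded k (\<lambda>u. f u ^ n)"
  by (induction n) (auto intro: cube_bounded_const cube_bounded_mult)

lemma cube_bounded_prod:
  assumes "\<And>i. i \<in> A \<Longrightarrow> cube_bounded k (f i)"
  shows "cube_bounded k (\<lambda>u. \<Prod>i\<in>A. f i u)"
  using assms by (induction A rule: infinite_finite_induct) (auto intro: cube_bounded_const cube_bounded_mult)

text \<open>Clamping the argument by \<open>max 0 (min 1 x)\<close> extends the function
  continuously from \<open>[0,1]\<close> to the real line, without changing it on the cube;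
  compactness of \<open>[0,1]\<close> gives the bound.\<close>

lemma cube_bounded_compose:
  assumes "continuous_on {0..1} \<phi>" "g \<in> borel_measurable (cube_measure k)"
    and "\<And>u. u \<in> unit_cube k \<Longrightarrow> g u \<in> {0..1::real}"
  shows "cube_bounded k (\<lambda>u. \<phi> (g u))"
proof -
  have "continuous_on UNIV (\<lambda>x. \<phi> (max 0 (min 1 x)))"
    by (rule continuous_on_compose2[OF assms(1)]) (auto intro!: continuous_intros)
  hence "(\<lambda>u. \<phi> (max 0 (min 1 (g u)))) \<in> borel_measurable (cube_measure k)"
    using assms(2) by (rule borel_measurable_continuous_on)
  hence "(\<lambda>u. indicator (unit_cube k) u *\<^sub>R \<phi> (max 0 (min 1 (g u)))) \<in> borel_measurable (cube_measure k)"
    using unit_cube_sets by (intro borel_measurable_scaleR borel_measurable_indicator)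
  moreover have "(\<lambda>u. indicator (unit_cube k) u *\<^sub>R \<phi> (max 0 (min 1 (g u)))) =
      (\<lambda>u. indicator (unit_cube k) u *\<^sub>R \<phi> (g u))"
    using assms(3) by (fastforce simp: indicator_def)
  moreover obtain B where "\<And>x. x \<in> {0..1} \<Longrightarrow> norm (\<phi> x) \<le> B"
    using compact_imp_bounded[OF compact_continuous_image[OF assms(1) compact_Icc]]
    unfolding bounded_iff by blast
  hence "\<exists>B. \<forall>u\<in>unit_cube k. norm (\<phi> (g u)) \<le> B" using assms(3) by blast
  ultimately show ?thesis unfolding cube_bounded_def by simp
qed

section \<open>Partial products and the substitution into the iterated integral\<close>

definition real_partial_prod :: "(nat \<Rightarrow> real) \<Rightarrow> nat \<Rightarrow> real" where
  "real_partial_prod u m = (\<Prod>h=1..m. u h)"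

lemma partial_prod_eq: "partial_prod u m = of_real (real_partial_prod u m)"
  by (simp add: partial_prod_def real_partial_prod_def)

lemma measurable_real_partial_prod:
  "h \<le> k \<Longrightarrow> (\<lambda>u. real_partial_prod u h) \<in> borel_measurable (cube_measure k)"
  unfolding real_partial_prod_def
  by (intro borel_measurable_prod) (auto intro: measurable_component_singleton[of _ _ "\<lambda>_. lborel", simplified])

lemma real_partial_prod_unit:
  "u \<in> unit_cube k \<Longrightarrow> h \<le> k \<Longrightarrow> real_partial_prod u h \<in> {0..1}"
  unfolding real_partial_prod_def by (auto intro!: prod_nonneg prod_le_1 simp: PiE_iff)

lemma slit_plane_scale:
  assumes "z \<in> slit_plane" "x \<in> {0..1}"
  shows "z * of_real x \<in> slit_plane"
  by (rule closed_segment_slit_plane[OF assms(1)])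
     (use assms(2) in \<open>auto simp: in_segment scaleR_conv_of_real mult.commute intro!: exI[of _ x]\<close>)

text \<open>
  The substitution \<open>t\<^bsub>h\<^esub> = z U\<^bsub>h\<^esub> = t\<^bsub>h-1\<^esub> u\<^bsub>h\<^esub>\<close> applied to the iterated integral, with the
  coordinates of index \<open>> k\<close> integrated out; the factors \<open>z U\<^bsub>h-1\<^esub>\<close> are the Jacobian.
\<close>

definition cube_form :: "nat \<Rightarrow> (nat \<Rightarrow> complex) \<Rightarrow> (nat \<Rightarrow> nat) \<Rightarrow> complex \<Rightarrow> nat \<Rightarrow> (nat \<Rightarrow> real) \<Rightarrow> complex" where
  "cube_form M \<omega> \<rho> z k u = (\<Prod>h=1..k. z * partial_prod u (h - 1)) *
     head_factor \<omega> \<rho> k (\<lambda>h. z * partial_prod u h) * tail_rem M \<omega> \<rho> k (z * partial_prod u k)"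

lemma continuous_on_slit_segment:
  assumes "z \<in> slit_plane" "f holomorphic_on slit_plane"
  shows "continuous_on {0..1} (\<lambda>x. f (z * of_real x))"
proof (rule continuous_on_compose2[where g = f and t = slit_plane])
  show "continuous_on slit_plane f" by (rule holomorphic_on_imp_continuous_on) fact
  show "(\<lambda>x. z * complex_of_real x) ` {0..1} \<subseteq> slit_plane"
    using slit_plane_scale[OF assms(1)] by blast
qed (intro continuous_intros)

lemma continuous_on_one_minus_powr:
  assumes "z \<in> slit_plane"
  shows "continuous_on {0..1} (\<lambda>x. (1 - z * of_real x) powr c)"
  by (rule continuous_on_slit_segment[OF assms], intro holomorphic_intros) (simp add: slit_plane_iff)

lemma continuous_on_inverse_one_minus:
  assumes "z \<in> slit_plane"
  shows "continuous_on {0..1} (\<lambda>x. inverse (1 - z * of_real x))"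
  by (rule continuous_on_slit_segment[OF assms], intro holomorphic_intros) (auto simp: slit_plane_iff)

lemma continuous_on_tail_rem:
  assumes "z \<in> slit_plane"
  shows "continuous_on {0..1} (\<lambda>x. tail_rem M \<omega> \<rho> k (z * of_real x))"
  unfolding tail_rem_def rem_def dd_def
  by (intro continuous_intros continuous_on_one_minus_powr assms)

lemma
  assumes "z \<in> slit_plane" "h \<le> k"
  shows cube_bounded_powr: "cube_bounded k (\<lambda>u. (1 - z * partial_prod u h) powr c)"
    and cube_bounded_inverse: "cube_bounded k (\<lambda>u. inverse (1 - z * partial_prod u h))"
    and cube_bounded_tail_rem: "cube_bounded k (\<lambda>u. tail_rem M \<omega> \<rho> l (z * partial_prod u h))"
  unfolding partial_prod_eq
  using cube_bounded_compose[OF _ measurable_real_partial_prod[OF assms(2)] real_partial_prod_unit[OF _ assms(2)]]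
    continuous_on_one_minus_powr[OF assms(1)] continuous_on_inverse_one_minus[OF assms(1)]
    continuous_on_tail_rem[OF assms(1)]
  by blast+

lemma cube_bounded_partial_prod:
  assumes "h \<le> k"
  shows "cube_bounded k (\<lambda>u. partial_prod u h)"
  unfolding partial_prod_eq
  using cube_bounded_compose[OF continuous_on_of_real_id measurable_real_partial_prod[OF assms]
    real_partial_prod_unit[OF _ assms]] .

lemma cube_bounded_coordinate:
  assumes "h \<in> {1..k}"
  shows "cube_bounded k (\<lambda>u. of_real (u h))"
  using assms
  by (intro cube_bounded_compose continuous_on_of_real_id)
     (auto simp: PiE_iff intro: measurable_component_singleton[of _ _ "\<lambda>_. lborel", simplified])

lemmas cube_bounded_intros = cube_bounded_const cube_bounded_mult cube_bounded_diff cube_bounded_power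
  cube_bounded_prod cube_bounded_partial_prod cube_bounded_coordinate

lemma cube_bounded_cube_form:
  assumes "z \<in> slit_plane"
  shows "cube_bounded k (cube_form M \<omega> \<rho> z k)"
  unfolding cube_form_def[abs_def] head_factor_def divide_inverse
  by (intro cube_bounded_intros cube_bounded_powr[OF assms] cube_bounded_inverse[OF assms]
        cube_bounded_tail_rem[OF assms]) auto

text \<open>With \<open>t = z U_k\<close> fixed, the substitution \<open>s = t y\<close> has
  derivative \<open>t\<close>, which is the new Jacobian factor of \<open>cube_form\<close>; the
  integral over \<open>y\<close> is then the one of \<open>tail_rem_recurrence\<close>.\<close>

lemma integral_last_coordinate:
  assumes "noncongruent \<omega> {..M}" "k < M" "z \<in> slit_plane" "u \<in> space (cube_measure k)"
  shows "(\<integral>y. indicator (unit_cube (Suc k)) (u(Suc k := y)) *\<^sub>R cube_form M \<omega> \<rho> z (Suc k) (u(Suc k := y)) \<partial>lborel)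
    = indicator (unit_cube k) u *\<^sub>R cube_form M \<omega> \<rho> z k u"
proof -
  have mem: "u(Suc k := y) \<in> unit_cube (Suc k) \<longleftrightarrow> u \<in> unit_cube k \<and> y \<in> {0..1}" for y
    using assms(4) by (auto simp: PiE_iff space_PiM extensional_def le_Suc_eq)
  show ?thesis
  proof (cases "u \<in> unit_cube k")
    case False
    thus ?thesis by (simp add: mem)
  next
    case True
    define t where "t = z * partial_prod u k"
    define K where "K = (\<lambda>s. ((t - s) / (1 - s)) ^ \<rho> k * (1 - s) powr (\<omega> (Suc k) - \<omega> k - 1) * tail_rem M \<omega> \<rho> (Suc k) s)"
    define C where "C = (\<Prod>h=1..k. z * partial_prod u (h - 1)) * head_factor \<omega> \<rho> k (\<lambda>h. z * partial_prod u h)"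
    have t: "t \<in> slit_plane"
      unfolding t_def partial_prod_eq using True by (intro slit_plane_scale assms real_partial_prod_unit) auto
    have pp: "partial_prod (u(Suc k := y)) h = partial_prod u h" if "h \<le> k" for y h
      unfolding partial_prod_def using that by (intro prod.cong) auto
    have pp': "z * partial_prod (u(Suc k := y)) (Suc k) = t * of_real y" for y
      using pp[of k y] by (simp add: partial_prod_def t_def)
    have form: "cube_form M \<omega> \<rho> z (Suc k) (u(Suc k := y)) = C * (K (t * of_real y) * t)" for y
    proof -
      have "head_factor \<omega> \<rho> k (\<lambda>h. z * partial_prod (u(Suc k := y)) h) = head_factor \<omega> \<rho> k (\<lambda>h. z * partial_prod u h)"
        by (rule head_factor_cong) (simp add: pp)
      moreover have "(\<Prod>h=1..k. z * partial_prod (u(Suc k := y)) (h - 1)) = (\<Prod>h=1..k. z * partial_prod u (h - 1))"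
        by (intro prod.cong refl arg_cong2[of _ _ _ _ "(*)"] pp) auto
      ultimately show ?thesis
        unfolding cube_form_def head_factor_Suc pp'
        by (simp add: pp C_def K_def t_def)
    qed
    have "(K has_contour_integral tail_rem M \<omega> \<rho> k t) (linepath 0 t)"
      unfolding K_def by (rule tail_rem_recurrence[OF assms(1,2) t])
    hence hk: "((\<lambda>y. K (t * of_real y) * t) has_integral tail_rem M \<omega> \<rho> k t) {0..1}"
      unfolding has_contour_integral_linepath
      by (simp add: linepath_def scaleR_conv_of_real mult.commute[of t])
    \<comment> \<open>The contour integral provides a Henstock-Kurzweil integral; continuity
      identifies it with the Lebesgue integral.\<close>
    have "continuous_on {0..1} (\<lambda>y. K (t * of_real y) * t)"
      unfolding K_def divide_inverse
      by (intro continuous_intros continuous_on_one_minus_powr continuous_on_inverse_one_minus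
          continuous_on_tail_rem t)
    hence "set_integrable lborel {0..1} (\<lambda>y. K (t * of_real y) * t)"
      by (rule borel_integrable_atLeastAtMost')
    from trans[OF set_borel_integral_eq_integral(2)[OF this] integral_unique[OF hk]]
    have "(LINT y:{0..1}|lborel. K (t * of_real y) * t) = tail_rem M \<omega> \<rho> k t" .
    hence "C * (LINT y:{0..1}|lborel. K (t * of_real y) * t) = cube_form M \<omega> \<rho> z k u"
      unfolding cube_form_def C_def t_def by simp
    moreover have "(\<integral>y. indicator (unit_cube (Suc k)) (u(Suc k := y)) *\<^sub>R cube_form M \<omega> \<rho> z (Suc k) (u(Suc k := y)) \<partial>lborel)
      = (LINT y:{0..1}|lborel. C * (K (t * of_real y) * t))"
      unfolding set_lebesgue_integral_def form
      by (intro Bochner_Integration.integral_cong refl) (use True in \<open>auto simp: mem indicator_def\<close>)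
    ultimately show ?thesis using True by simp
  qed
qed

text \<open>Fubini removes the last coordinate at each step, so the value does not depend on
  \<open>k\<close> and can be read off at \<open>k = 0\<close>.\<close>

lemma integral_cube_form:
  assumes "noncongruent \<omega> {..M}" "z \<in> slit_plane"
  shows "k \<le> M \<Longrightarrow> (LINT u:unit_cube k|cube_measure k. cube_form M \<omega> \<rho> z k u) = tail_rem M \<omega> \<rho> 0 z"
proof (induction k)
  case 0
  \<comment> \<open>The product measure over no coordinates is the unit mass at the one function in
    its space.\<close>
  have "integral\<^sup>L (cube_measure 0) f = f (\<lambda>_. undefined)" for f :: "_ \<Rightarrow> complex"
    by (simp add: PiM_empty lebesgue_integral_count_space_finite)
  thus ?case by (simp add: set_lebesgue_integral_def cube_form_def head_factor_def partial_prod_def)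
next
  case (Suc k)
  have ins: "{1..Suc k} = insert (Suc k) {1..k}" by auto
  have "integrable (\<Pi>\<^sub>M h\<in>insert (Suc k) {1..k}. lborel)
    (\<lambda>u. indicator (unit_cube (Suc k)) u *\<^sub>R cube_form M \<omega> \<rho> z (Suc k) u)"
    using cube_bounded_set_integrable[OF cube_bounded_cube_form[OF assms(2)], of "Suc k" M \<omega> \<rho>]
    unfolding set_integrable_def ins[symmetric] .
  hence "(LINT u:unit_cube (Suc k)|cube_measure (Suc k). cube_form M \<omega> \<rho> z (Suc k) u)
    = (\<integral>u. (\<integral>y. indicator (unit_cube (Suc k)) (u(Suc k := y)) *\<^sub>R cube_form M \<omega> \<rho> z (Suc k) (u(Suc k := y)) \<partial>lborel) \<partial>cube_measure k)"
    unfolding set_lebesgue_integral_def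
    by (subst ins, intro lborel_product.product_integral_insert) auto
  also have "\<dots> = (LINT u:unit_cube k|cube_measure k. cube_form M \<omega> \<rho> z k u)"
    unfolding set_lebesgue_integral_def using Suc.prems
    by (intro Bochner_Integration.integral_cong refl integral_last_coordinate assms) auto
  also have "\<dots> = tail_rem M \<omega> \<rho> 0 z" using Suc by simp
  finally show ?case .
qed

text \<open>The integrand after cancelling the inverse of \<open>partial_prod u M\<close> and
  shifting the powers of the partial products by one index. It has no singularity where a coordinate
  vanishes.\<close>

definition reduced_cube_integrand ::
  "nat \<Rightarrow> (nat \<Rightarrow> complex) \<Rightarrow> (nat \<Rightarrow> nat) \<Rightarrow> complex \<Rightarrow> (nat \<Rightarrow> real) \<Rightarrow> complex" where
  "reduced_cube_integrand M \<omega> \<rho> z u = partial_prod u M ^ \<rho> M *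
     (\<Prod>h=1..M. partial_prod u (h - 1) ^ (1 + \<rho> (h - 1)) *
        ((1 - z * partial_prod u h) powr (\<omega> h - \<omega> (h - 1) - 1) *
        ((1 - of_real (u h)) * inverse (1 - z * partial_prod u h)) ^ \<rho> (h - 1)))"

text \<open>Both sides are the product of \<open>a 0, ..., a M\<close>.\<close>

lemma prod_shift_index:
  fixes a :: "nat \<Rightarrow> 'a :: comm_monoid_mult"
  shows "(\<Prod>h=1..M. a h) * a 0 = (\<Prod>h=1..M. a (h - 1)) * a M"
proof (induction M)
  case (Suc M)
  have "(\<Prod>h=1..Suc M. a h) * a 0 = a (Suc M) * ((\<Prod>h=1..M. a h) * a 0)"
    by (simp add: mult_ac)
  also have "\<dots> = a (Suc M) * ((\<Prod>h=1..M. a (h - 1)) * a M)" by (simp only: Suc.IH)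
  also have "\<dots> = (\<Prod>h=1..Suc M. a (h - 1)) * a (Suc M)" by (simp add: mult_ac)
  finally show ?case .
qed simp

text \<open>
  Where \<open>partial_prod u M = 0\<close>, the value \<open>0\<close> is an artefact of \<open>inverse 0 = 0\<close>.
\<close>

lemma cube_integrand_eq:
  "cube_integrand M \<omega> \<rho> z u =
     (if partial_prod u M = 0 then 0 else reduced_cube_integrand M \<omega> \<rho> z u)"
proof (cases "partial_prod u M = 0")
  case False
  define E where "E = (\<Prod>h=1..M. (1 - z * partial_prod u h) powr (\<omega> h - \<omega> (h - 1) - 1) *
        ((1 - of_real (u h)) * inverse (1 - z * partial_prod u h)) ^ \<rho> (h - 1))"
  have "(\<Prod>h=1..M. partial_prod u h ^ (1 + \<rho> h)) =
      (\<Prod>h=1..M. partial_prod u (h - 1) ^ (1 + \<rho> (h - 1))) * partial_prod u M ^ (1 + \<rho> M)"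
    using prod_shift_index[of "\<lambda>h. partial_prod u h ^ (1 + \<rho> h)" M] by (simp add: partial_prod_def)
  hence "inverse (partial_prod u M) * (\<Prod>h=1..M. partial_prod u h ^ (1 + \<rho> h)) =
      partial_prod u M ^ \<rho> M * (\<Prod>h=1..M. partial_prod u (h - 1) ^ (1 + \<rho> (h - 1)))"
    using False by (simp add: power_add)
  moreover have "cube_integrand M \<omega> \<rho> z u =
      inverse (partial_prod u M) * (\<Prod>h=1..M. partial_prod u h ^ (1 + \<rho> h)) * E"
  proof -
    have "a / b powr (1 - c + d) * e = a * (b powr (c - d - 1) * e)" for a b c d e :: complex
      using powr_minus_divide[of b "1 - c + d"] by (simp add: algebra_simps)
    thus ?thesis
      unfolding cube_integrand_def E_def mult.assoc prod.distrib[symmetric] divide_inverse[of "1 - complex_of_real _"]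
      by simp
  qed
  ultimately show ?thesis
    using False by (simp add: reduced_cube_integrand_def E_def prod.distrib mult_ac)
qed (simp add: cube_integrand_def)

text \<open>At \<open>t_h = z U_h\<close> one has
  \<open>t_(h-1) - t_h = z U_(h-1) (1 - u_h)\<close>, so with the Jacobian each \<open>h\<close>
  gives \<open>z\<close> to the power \<open>1 + \<rho> (h - 1)\<close>. The tail gives
  \<open>z ^ \<rho> M\<close>, and the exponents add up to \<open>\<sigma> - 1\<close>.\<close>

lemma cube_form_eq_reduced:
  assumes "z \<in> slit_plane" "u \<in> unit_cube M"
  shows "cube_form M \<omega> \<rho> z M u = z ^ (vec_size M \<rho> - 1) * reduced_cube_integrand M \<omega> \<rho> z u"
proof -
  define U where "U = partial_prod u"
  have "z * U M \<in> slit_plane"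
    unfolding U_def partial_prod_eq using assms by (intro slit_plane_scale real_partial_prod_unit) auto
  hence "tail_rem M \<omega> \<rho> M (z * U M) = (z * U M) ^ \<rho> M" by (rule tail_rem_last)
  moreover have "(\<Prod>h=1..M. z * U (h - 1)) * head_factor \<omega> \<rho> M (\<lambda>h. z * U h) =
     (\<Prod>h=1..M. z ^ (1 + \<rho> (h - 1)) * (U (h - 1) ^ (1 + \<rho> (h - 1)) *
        ((1 - z * U h) powr (\<omega> h - \<omega> (h - 1) - 1) *
        ((1 - of_real (u h)) * inverse (1 - z * U h)) ^ \<rho> (h - 1))))"
    unfolding head_factor_def prod.distrib[symmetric]
  proof (rule prod.cong[OF refl])
    fix h assume "h \<in> {1..M}"
    then obtain j where j: "h = Suc j" by (cases h) auto
    have "U h = U (h - 1) * of_real (u h)" by (simp add: U_def partial_prod_def j)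
    hence "(z * U (h - 1) - z * U h) / (1 - z * U h) =
      z * U (h - 1) * ((1 - of_real (u h)) * inverse (1 - z * U h))"
      by (simp add: divide_inverse algebra_simps)
    thus "z * U (h - 1) * (((z * U (h - 1) - z * U h) / (1 - z * U h)) ^ \<rho> (h - 1) *
        (1 - z * U h) powr (\<omega> h - \<omega> (h - 1) - 1)) =
      z ^ (1 + \<rho> (h - 1)) * (U (h - 1) ^ (1 + \<rho> (h - 1)) *
        ((1 - z * U h) powr (\<omega> h - \<omega> (h - 1) - 1) *
        ((1 - of_real (u h)) * inverse (1 - z * U h)) ^ \<rho> (h - 1)))"
      by (simp add: power_mult_distrib power_add)
  qed
  moreover have "z ^ (vec_size M \<rho> - 1) = z ^ \<rho> M * (\<Prod>h=1..M. z ^ (1 + \<rho> (h - 1)))"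
  proof -
    have "vec_size M \<rho> = (\<Sum>h=1..M. 1 + \<rho> (h - 1)) + (\<rho> M + 1)"
      unfolding vec_size_def by (induction M) auto
    thus ?thesis by (simp add: power_add power_sum mult.commute)
  qed
  ultimately show ?thesis
    unfolding cube_form_def reduced_cube_integrand_def U_def[symmetric] prod.distrib[of "\<lambda>h. z ^ (1 + \<rho> (h - 1))"]
    by (simp add: power_mult_distrib)
qed

text \<open>The product vanishes only on finitely many coordinate hyperplanes. Each is a box with
  one side \<open>{0}\<close>, which makes its measure \<open>0\<close> although the other sides are
  infinite.\<close>

lemma AE_partial_prod_nonzero: "AE u in cube_measure M. partial_prod u M \<noteq> 0"
proof -
  have "AE u in cube_measure M. u h \<noteq> 0" if "h \<in> {1..M}" for h
  proof (rule AE_I')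
    let ?A = "\<Pi>\<^sub>E i\<in>{1..M}. if i = h then {0} else (UNIV :: real set)"
    have "emeasure (cube_measure M) ?A = (\<Prod>i\<in>{1..M}. emeasure lborel (if i = h then {0} else (UNIV :: real set)))"
      by (rule lborel_product.emeasure_PiM) auto
    also have "\<dots> = 0" using that by (intro prod_zero) (auto intro!: bexI[of _ h])
    finally show "?A \<in> null_sets (cube_measure M)"
      by (intro null_setsI sets_PiM_I_finite) auto
    show "{u \<in> space (cube_measure M). \<not> u h \<noteq> 0} \<subseteq> ?A"
      by (auto simp: space_PiM PiE_iff extensional_def)
  qed
  hence "AE u in cube_measure M. \<forall>h\<in>{1..M}. u h \<noteq> 0" by (intro AE_finite_allI) auto
  thus ?thesis by eventually_elim (auto simp: partial_prod_def)
qed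

text \<open>The reduced integrand is bounded, and the given one differs from it only on the null set
  \<open>partial_prod u M = 0\<close>, so both have the same integral.\<close>

lemma
  assumes "noncongruent \<omega> {..M}" "z \<in> slit_plane"
  shows set_integrable_cube_integrand:
      "set_integrable (cube_measure M) (unit_cube M) (cube_integrand M \<omega> \<rho> z)"
    and rem_eq_cube_integral: "rem (node_set \<omega> \<rho> {..M}) z =
      z ^ (vec_size M \<rho> - 1) * ((1 - z) powr \<omega> 0 / vec_fact M \<rho>) *
      (LINT u:unit_cube M|cube_measure M. cube_integrand M \<omega> \<rho> z u)"
proof -
  have red: "cube_bounded M (reduced_cube_integrand M \<omega> \<rho> z)"
    unfolding reduced_cube_integrand_def[abs_def] by (intro cube_bounded_intros cube_bounded_powr[OF assms(2)]
        cube_bounded_inverse[OF assms(2)]) auto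
  have "cube_bounded M (\<lambda>u. if partial_prod u M = 0 then 0 else 1)"
    unfolding partial_prod_eq of_real_eq_0_iff
    using measurable_real_partial_prod[of M M]
    by (intro cube_bounded_of_borel[where B = 1] measurable_If) auto
  hence "cube_bounded M (\<lambda>u. (if partial_prod u M = 0 then 0 else 1) * reduced_cube_integrand M \<omega> \<rho> z u)"
    by (rule cube_bounded_mult[OF _ red])
  also have "(\<lambda>u. (if partial_prod u M = 0 then 0 else 1) * reduced_cube_integrand M \<omega> \<rho> z u) =
      cube_integrand M \<omega> \<rho> z"
    by (auto simp: cube_integrand_eq fun_eq_iff)
  finally have cb: "cube_bounded M (cube_integrand M \<omega> \<rho> z)" .
  thus "set_integrable (cube_measure M) (unit_cube M) (cube_integrand M \<omega> \<rho> z)"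
    by (rule cube_bounded_set_integrable)
  have "(LINT u:unit_cube M|cube_measure M. cube_integrand M \<omega> \<rho> z u)
      = (LINT u:unit_cube M|cube_measure M. reduced_cube_integrand M \<omega> \<rho> z u)"
    unfolding set_lebesgue_integral_def
  proof (rule integral_cong_AE)
    show "AE u in cube_measure M. indicat_real (unit_cube M) u *\<^sub>R cube_integrand M \<omega> \<rho> z u =
      indicat_real (unit_cube M) u *\<^sub>R reduced_cube_integrand M \<omega> \<rho> z u"
      using AE_partial_prod_nonzero by eventually_elim (simp add: cube_integrand_eq)
  qed (use cb red in \<open>auto simp: cube_bounded_def\<close>)
  hence "z ^ (vec_size M \<rho> - 1) * (LINT u:unit_cube M|cube_measure M. cube_integrand M \<omega> \<rho> z u)
      = (LINT u:unit_cube M|cube_measure M. z ^ (vec_size M \<rho> - 1) * reduced_cube_integrand M \<omega> \<rho> z u)"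
    by simp
  also have "\<dots> = (LINT u:unit_cube M|cube_measure M. cube_form M \<omega> \<rho> z M u)"
    using cube_form_eq_reduced[OF assms(2)]
    by (intro set_lebesgue_integral_cong unit_cube_sets) auto
  also have "\<dots> = tail_rem M \<omega> \<rho> 0 z" by (rule integral_cube_form[OF assms order.refl])
  finally have *: "z ^ (vec_size M \<rho> - 1) * (LINT u:unit_cube M|cube_measure M. cube_integrand M \<omega> \<rho> z u)
      = vec_fact M \<rho> * (1 - z) powr (- \<omega> 0) * rem (node_set \<omega> \<rho> {..M}) z"
    by (simp add: tail_rem_def vec_fact_def atLeast0AtMost)
  have "z \<noteq> 1" using assms(2) by (auto simp: slit_plane_iff)
  moreover have "vec_fact M \<rho> \<noteq> 0" by (simp add: vec_fact_def)
  ultimately have "rem (node_set \<omega> \<rho> {..M}) z = (1 - z) powr \<omega> 0 / vec_fact M \<rho> *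
      (vec_fact M \<rho> * (1 - z) powr (- \<omega> 0) * rem (node_set \<omega> \<rho> {..M}) z)"
    by (simp add: powr_minus)
  thus "rem (node_set \<omega> \<rho> {..M}) z =
      z ^ (vec_size M \<rho> - 1) * ((1 - z) powr \<omega> 0 / vec_fact M \<rho>) *
      (LINT u:unit_cube M|cube_measure M. cube_integrand M \<omega> \<rho> z u)"
    unfolding *[symmetric] by (simp add: mult_ac)
qed

declare One_nat_def [simp]


section \<open>Contour integrals\<close>

lemma holomorphic_powr_exponent:
  fixes a :: complex
  assumes "a \<noteq> 0"
  shows "(\<lambda>\<xi>. a powr \<xi>) holomorphic_on A" and "(\<lambda>\<xi>. a powr (- \<xi>)) holomorphic_on A"
  using assms by (auto simp: powr_def intro!: holomorphic_intros)

text \<open>The residue form of the divided difference. Reversing the \<open>\<sigma>\<close>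
  differences \<open>\<xi> - x\<close> gives \<open>(-1)^\<sigma>\<close>, and the minus sign in
  \<open>has_contour_integral_dd\<close> changes this to \<open>(-1)^(\<sigma> - 1)\<close>.\<close>

lemma rem_eq_contour_integral:
  assumes "noncongruent \<omega> {..M}" "z \<noteq> 1"
    and "valid_path \<gamma>" "pathfinish \<gamma> = pathstart \<gamma>" "node_set \<omega> \<rho> {..M} \<inter> path_image \<gamma> = {}"
    and "\<And>x. x \<in> node_set \<omega> \<rho> {..M} \<Longrightarrow> winding_number \<gamma> x = 1"
  defines "f \<equiv> \<lambda>\<xi>. (1 - z) powr \<xi> * (\<Prod>k\<le>M. 1 / ffact (\<xi> - \<omega> k) (\<rho> k + 1))"
  shows "f contour_integrable_on \<gamma>"
    and "rem (node_set \<omega> \<rho> {..M}) z =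
      (- 1) ^ (vec_size M \<rho> - 1) / (2 * of_real pi * \<i>) * contour_integral \<gamma> f"
proof -
  define X where "X = node_set \<omega> \<rho> {..M}"
  have X: "card X = vec_size M \<rho>"
    using card_node_set[OF _ assms(1)] by (simp add: X_def vec_size_def)
  obtain N where N: "vec_size M \<rho> = Suc N"
    by (cases "vec_size M \<rho>") (auto simp: vec_size_def)
  have f_eq: "f \<xi> = (- 1) ^ vec_size M \<rho> * ((1 - z) powr \<xi> / (\<Prod>x\<in>X. x - \<xi>))" for \<xi>
  proof -
    have "(\<Prod>k\<le>M. ffact (\<xi> - \<omega> k) (\<rho> k + 1)) = (\<Prod>x\<in>X. \<xi> - x)"
      unfolding X_def prod_node_set[OF finite_atMost assms(1)]
      by (simp add: ffact_def lessThan_Suc_atMost algebra_simps)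
    also have "\<dots> = (\<Prod>x\<in>X. - 1 * (x - \<xi>))" by simp
    also have "\<dots> = (- 1) ^ vec_size M \<rho> * (\<Prod>x\<in>X. x - \<xi>)"
      unfolding prod.distrib by (simp add: X)
    finally have "f \<xi> = (1 - z) powr \<xi> / ((- 1) ^ vec_size M \<rho> * (\<Prod>x\<in>X. x - \<xi>))"
      by (simp add: f_def prod_dividef)
    thus ?thesis by (cases "even (vec_size M \<rho>)") simp_all
  qed
  have "((\<lambda>\<xi>. (- 1) ^ vec_size M \<rho> * ((1 - z) powr \<xi> / (\<Prod>x\<in>X. x - \<xi>))) has_contour_integral
     (- 1) ^ vec_size M \<rho> * (- (2 * of_real pi * \<i>) * dd X (\<lambda>\<xi>. (1 - z) powr \<xi>))) \<gamma>"
    using assms(2-6)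
    by (intro has_contour_integral_lmul has_contour_integral_dd holomorphic_powr_exponent) (auto simp: X_def)
  hence *: "(f has_contour_integral (- 1) ^ N * (2 * of_real pi * \<i>) * rem X z) \<gamma>"
    unfolding f_eq[symmetric] by (simp add: N rem_def mult.assoc)
  thus "f contour_integrable_on \<gamma>" by (auto simp: contour_integrable_on_def)
  show "rem (node_set \<omega> \<rho> {..M}) z =
      (- 1) ^ (vec_size M \<rho> - 1) / (2 * of_real pi * \<i>) * contour_integral \<gamma> f"
    using contour_integral_unique[OF *] by (simp add: N X_def flip: power_mult_distrib)
qed


section \<open>The Meijer G-function\<close>

text \<open>The substitution \<open>\<xi> = - s\<close>, carried out on the nodes instead of the
  path. For \<open>card X = N + 1\<close>, the product contributes \<open>(-1)^(N + 1)\<close> and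
  the weights \<open>(-1)^N\<close>; with the minus sign of \<open>has_contour_integral_dd\<close>
  everything cancels.\<close>

lemma has_contour_integral_reflected:
  assumes "finite X" "X \<noteq> {}" "z \<noteq> 1"
    and "valid_path \<gamma>" "pathfinish \<gamma> = pathstart \<gamma>" "uminus ` X \<inter> path_image \<gamma> = {}"
    and "\<And>x. x \<in> X \<Longrightarrow> winding_number \<gamma> (- x) = 1"
  shows "((\<lambda>s. (1 - z) powr (- s) / (\<Prod>x\<in>X. s + x)) has_contour_integral
    2 * of_real pi * \<i> * rem X z) \<gamma>"
proof -
  obtain N where N: "card X = Suc N" using assms(1,2) by (cases "card X") auto
  have prod: "(\<Prod>y\<in>uminus ` X. y - s) = (- 1) ^ Suc N * (\<Prod>x\<in>X. s + x)" for s
  proof -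
    have "(\<Prod>y\<in>uminus ` X. y - s) = (\<Prod>x\<in>X. - 1 * (s + x))"
      by (subst prod.reindex, simp add: inj_on_def, intro prod.cong refl, simp)
    thus ?thesis unfolding prod.distrib by (simp add: N)
  qed
  have wt: "wt (uminus ` X) (- x) = (- 1) ^ N * wt X x" if "x \<in> X" for x
  proof -
    have "uminus ` X - {- x} = uminus ` (X - {x})" by auto
    hence "(\<Prod>y\<in>uminus ` X - {- x}. y - - x) = (\<Prod>y\<in>X - {x}. - 1 * (y - x))"
      by (simp add: prod.reindex inj_on_def)
    also have "\<dots> = (- 1) ^ N * (\<Prod>y\<in>X - {x}. y - x)"
      unfolding prod.distrib using that by (simp add: N)
    finally show ?thesis by (cases "even N") (simp_all add: wt_def)
  qed
  have dd: "dd (uminus ` X) (\<lambda>s. (1 - z) powr (- s)) = (- 1) ^ N * rem X z"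
    unfolding dd_def rem_def
    by (subst sum.reindex) (auto simp: inj_on_def wt sum_distrib_left mult_ac intro!: sum.cong)
  have "((\<lambda>s. (- 1) ^ Suc N * ((1 - z) powr (- s) / (\<Prod>y\<in>uminus ` X. y - s))) has_contour_integral
    (- 1) ^ Suc N * (- (2 * of_real pi * \<i>) * dd (uminus ` X) (\<lambda>s. (1 - z) powr (- s)))) \<gamma>"
    using assms
    by (intro has_contour_integral_lmul has_contour_integral_dd holomorphic_powr_exponent) auto
  thus ?thesis unfolding prod dd by (cases "even N") simp_all
qed

text \<open>The left poles are excluded because \<open>Gamma\<close> is \<open>0\<close> there by
  convention: at \<open>- \<omega> k - j\<close> with \<open>j > \<rho> k\<close> the singularity of
  the quotient is removable, but the formal quotient is \<open>0\<close> and not the limit.\<close>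

lemma meijer_integrand_eq:
  fixes \<rho> :: "nat \<Rightarrow> nat"
  assumes "noncongruent \<omega> {..M}" "s \<notin> meijer_left_poles (M + 1) (map \<omega> [0..<M + 1])"
  shows "meijer_integrand (M + 1) 0 (map (\<lambda>k. \<omega> k + of_nat (\<rho> k) + 1) [0..<M + 1])
      (map \<omega> [0..<M + 1]) x s = x powr (- s) / (\<Prod>y\<in>node_set \<omega> \<rho> {..M}. s + y)"
proof -
  have ni: "s + \<omega> k \<notin> \<int>\<^sub>\<le>\<^sub>0" if "k \<le> M" for k
  proof
    assume "s + \<omega> k \<in> \<int>\<^sub>\<le>\<^sub>0"
    then obtain j where "s + \<omega> k = - of_nat j" by (elim nonpos_Ints_cases')
    hence "s = - (map \<omega> [0..<M + 1] ! k) - of_nat j"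
      using that by (simp add: algebra_simps eq_neg_iff_add_eq_0 del: upt_Suc)
    thus False using assms(2) that unfolding meijer_left_poles_def by auto
  qed
  have "(\<Prod>k<M + 1. Gamma (s + map \<omega> [0..<M + 1] ! k)) /
      (\<Prod>k=0..<M + 1. Gamma (s + map (\<lambda>k. \<omega> k + of_nat (\<rho> k) + 1) [0..<M + 1] ! k))
    = (\<Prod>k<M + 1. Gamma (s + \<omega> k) / Gamma (s + (\<omega> k + of_nat (\<rho> k) + 1)))"
    unfolding prod_dividef atLeast0LessThan
    by (intro arg_cong2[of _ _ _ _ "(/)"] prod.cong refl) (simp_all del: upt_Suc)
  also have "\<dots> = (\<Prod>k\<le>M. 1 / pochhammer (s + \<omega> k) (\<rho> k + 1))"
    unfolding Suc_eq_plus1[symmetric] lessThan_Suc_atMost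
  proof (rule prod.cong[OF refl])
    fix k assume "k \<in> {..M}"
    hence "pochhammer (s + \<omega> k) (Suc (\<rho> k)) = Gamma (s + \<omega> k + of_nat (Suc (\<rho> k))) / Gamma (s + \<omega> k)"
      using ni by (intro pochhammer_Gamma) auto
    thus "Gamma (s + \<omega> k) / Gamma (s + (\<omega> k + of_nat (\<rho> k) + 1)) = 1 / pochhammer (s + \<omega> k) (Suc (\<rho> k))"
      by (simp add: add_ac)
  qed
  also have "\<dots> = 1 / (\<Prod>y\<in>node_set \<omega> \<rho> {..M}. s + y)"
    unfolding prod_node_set[OF finite_atMost assms(1)]
    by (simp add: prod_dividef pochhammer_Suc_prod atLeast0AtMost add.assoc)
  finally show ?thesis by (simp add: meijer_integrand_def atLeast0LessThan del: upt_Suc)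
qed

section \<open>Truncated and closed loops\<close>

lemma valid_path_loop_trunc: "valid_path \<gamma> \<Longrightarrow> valid_path (loop_trunc \<gamma> R)"
  unfolding loop_trunc_def by (intro valid_path_join) auto

lemma loop_trunc_ends:
  "pathstart (loop_trunc \<gamma> R) = Complex (- R) (Im (pathstart \<gamma>))"
  "pathfinish (loop_trunc \<gamma> R) = Complex (- R) (Im (pathfinish \<gamma>))"
  by (auto simp: loop_trunc_def)

lemma loop_trunc_mono:
  assumes "R \<ge> - Re (pathstart \<gamma>)" "R \<ge> - Re (pathfinish \<gamma>)" "R \<le> S"
  shows "path_image (loop_trunc \<gamma> R) \<subseteq> path_image (loop_trunc \<gamma> S)"
proof -
  have "path_image (loop_trunc \<gamma> T) =
      {w. Im w = Im (pathstart \<gamma>) \<and> - T \<le> Re w \<and> Re w \<le> Re (pathstart \<gamma>)} \<union> path_image \<gamma> \<union>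
      {w. Im w = Im (pathfinish \<gamma>) \<and> - T \<le> Re w \<and> Re w \<le> Re (pathfinish \<gamma>)}" if "T \<ge> R" for T
    using that assms unfolding loop_trunc_def
    by (auto simp: path_image_join closed_segment_same_Im closed_segment_eq_real_ivl)
  from this[of R] this[of S] assms show ?thesis by auto
qed

text \<open>A pole on one truncation lies on all longer ones, contradicting the eventual avoidance
  of that pole. This handles infinitely many poles at once, which eventuality pole by pole would
  not.\<close>

lemma loop_trunc_avoids:
  assumes "\<And>p. p \<in> L \<Longrightarrow> \<forall>\<^sub>F R in at_top. p \<notin> path_image (loop_closed \<gamma> R)" "valid_path \<gamma>"
    and "R \<ge> - Re (pathstart \<gamma>)" "R \<ge> - Re (pathfinish \<gamma>)"
  shows "path_image (loop_trunc \<gamma> R) \<inter> L = {}"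
proof (rule ccontr)
  assume "\<not> ?thesis"
  then obtain p where p: "p \<in> path_image (loop_trunc \<gamma> R)" "p \<in> L" by blast
  have "\<forall>\<^sub>F S in at_top. p \<notin> path_image (loop_closed \<gamma> S) \<and> S \<ge> R"
    by (intro eventually_conj assms(1) p(2) eventually_ge_at_top)
  then obtain S where S: "p \<notin> path_image (loop_closed \<gamma> S)" "S \<ge> R"
    by (auto simp: eventually_at_top_linorder)
  have "p \<in> path_image (loop_trunc \<gamma> S)" using loop_trunc_mono[OF assms(3,4) S(2)] p(1) by blast
  thus False using S(1) by (simp add: loop_closed_def path_image_join loop_trunc_ends)
qed

text \<open>The middle part is the right side of a rectangle so large that all poles, which extend
  only to the left, lie strictly within its height and to its left.\<close>

lemma exists_meijer_loop: "\<exists>\<gamma>. meijer_loop (M + 1) 0 as (map \<omega> [0..<M + 1]) \<gamma>"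
proof -
  define B where "B = 1 + (\<Sum>k\<le>M. norm (\<omega> k))"
  define \<gamma> where "\<gamma> = linepath (Complex B (- B)) (Complex B B)"
  have B: "norm (\<omega> k) < B" if "k \<le> M" for k
    using member_le_sum[of k "{..M}" "\<lambda>k. norm (\<omega> k)"] that by (simp add: B_def)
  have "p \<notin> path_image (loop_closed \<gamma> R) \<and> winding_number (loop_closed \<gamma> R) p = 1"
    if p: "p \<in> meijer_left_poles (M + 1) (map \<omega> [0..<M + 1])" and R: "R > - Re p" for p R
  proof -
    obtain k j where kj: "k \<le> M" "p = - \<omega> k - of_nat j"
      using p unfolding meijer_left_poles_def by (auto simp: less_Suc_eq_le simp del: upt_Suc)
    have "\<bar>Im p\<bar> < B" using B[OF kj(1)] abs_Im_le_cmod[of "\<omega> k"] by (simp add: kj(2))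
    moreover have "Re p < B" using B[OF kj(1)] abs_Re_le_cmod[of "\<omega> k"] by (simp add: kj(2))
    ultimately have box: "p \<in> box (Complex (- R) (- B)) (Complex B B)"
      using R by (auto simp: in_box_complex_iff abs_less_iff)
    let ?a = "Complex (- R) (- B)" and ?b = "Complex B (- B)" and ?c = "Complex B B" and ?d = "Complex (- R) B"
    have "- R < B" "- B < B" using box by (auto simp: in_box_complex_iff)
    hence "p \<notin> path_image (rectpath ?a ?c)"
      using box by (subst path_image_rectpath_cbox_minus_box) auto
    hence *: "p \<notin> path_image (linepath ?a ?b)" "p \<notin> path_image (linepath ?b ?c)"
        "p \<notin> path_image (linepath ?c ?d)" "p \<notin> path_image (linepath ?d ?a)"
      by (auto simp: rectpath_def Let_def path_image_join)
    \<comment> \<open>This is the rectangle's boundary up to the bracketing of the joins, so winding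
      numbers are compared instead of the paths.\<close>
    have loop: "loop_closed \<gamma> R = (linepath ?a ?b +++ linepath ?b ?c +++ linepath ?c ?d) +++ linepath ?d ?a"
      by (simp add: loop_closed_def loop_trunc_def \<gamma>_def)
    have "winding_number (loop_closed \<gamma> R) p = winding_number (rectpath ?a ?c) p"
      unfolding loop using * by (simp add: rectpath_def Let_def winding_number_join path_image_join)
    moreover have "p \<notin> path_image (loop_closed \<gamma> R)"
      unfolding loop using * by (simp add: path_image_join)
    ultimately show ?thesis using winding_number_rectpath[OF box] by simp
  qed
  hence "meijer_loop (M + 1) 0 as (map \<omega> [0..<M + 1]) \<gamma>"
    unfolding meijer_loop_def
    by (auto simp: \<gamma>_def meijer_right_poles_def simp del: upt_Suc
        intro!: eventually_mono[OF eventually_gt_at_top])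
  thus ?thesis by blast
qed

text \<open>On \<open>Re s = - R\<close> the power \<open>x powr (- s)\<close> decays exponentially
  because \<open>norm x < 1\<close>, while the denominator stays away from \<open>0\<close> and the
  length of the segment is fixed.\<close>

lemma closing_segment_tendsto_0:
  fixes b c :: real
  assumes "finite X" "0 < norm x" "norm x < 1"
    and "\<forall>\<^sub>F R in at_top. (\<lambda>s. x powr (- s) / (\<Prod>y\<in>X. s + y)) contour_integrable_on linepath (Complex (- R) b) (Complex (- R) c)"
  shows "((\<lambda>R. contour_integral (linepath (Complex (- R) b) (Complex (- R) c))
    (\<lambda>s. x powr (- s) / (\<Prod>y\<in>X. s + y))) \<longlongrightarrow> 0) at_top"
proof (rule Lim_null_comparison)
  define l where "l = - ln (norm x)"
  \<comment> \<open>Bounds the contribution of the argument of \<open>x\<close>: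
    \<open>Im (Ln x)\<close> is at most \<open>pi\<close> in modulus, and \<open>Im s\<close> at
    most \<open>\<bar>b\<bar> + \<bar>c\<bar>\<close>.\<close>
  define C where "C = pi * (\<bar>b\<bar> + \<bar>c\<bar>)"
  have l: "l > 0" using assms by (simp add: l_def)
  have x: "x \<noteq> 0" using assms(2) by auto
  show "((\<lambda>R. exp (C - l * R) * \<bar>c - b\<bar>) \<longlongrightarrow> 0) at_top"
  proof -
    have "filterlim (\<lambda>R. C - l * R) at_bot at_top"
      unfolding filterlim_at_bot
    proof
      fix Z
      show "\<forall>\<^sub>F R in at_top. C - l * R \<le> Z"
        using eventually_ge_at_top[of "(C - Z) / l"]
        by eventually_elim (use l in \<open>simp add: field_simps\<close>)
    qed
    hence "((\<lambda>R. exp (C - l * R)) \<longlongrightarrow> 0) at_top" by (rule filterlim_compose[OF exp_at_bot])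
    from tendsto_mult_left_zero[OF this] show ?thesis .
  qed
  \<comment> \<open>From here on \<open>\<bar>Re (s + y)\<bar> \<ge> 1\<close> for every
    \<open>y \<in> X\<close>, so each factor of the denominator has norm at least
    \<open>1\<close>.\<close>
  have "\<forall>\<^sub>F R in at_top. R \<ge> 1 + (\<Sum>y\<in>X. norm y)" by (rule eventually_ge_at_top)
  with assms(4) show "\<forall>\<^sub>F R in at_top. norm (contour_integral (linepath (Complex (- R) b) (Complex (- R) c))
    (\<lambda>s. x powr (- s) / (\<Prod>y\<in>X. s + y))) \<le> exp (C - l * R) * \<bar>c - b\<bar>"
  proof eventually_elim
    case (elim R)
    have "norm (contour_integral (linepath (Complex (- R) b) (Complex (- R) c))
      (\<lambda>s. x powr (- s) / (\<Prod>y\<in>X. s + y))) \<le> exp (C - l * R) * norm (Complex (- R) c - Complex (- R) b)"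
    proof (rule has_contour_integral_bound_linepath[OF has_contour_integral_integral[OF elim(1)]])
      fix s assume "s \<in> closed_segment (Complex (- R) b) (Complex (- R) c)"
      hence s: "Re s = - R" "Im s \<in> closed_segment b c" by (auto simp: closed_segment_same_Re)
      have "\<bar>Im s\<bar> \<le> \<bar>b\<bar> + \<bar>c\<bar>"
        using s(2) by (auto simp: closed_segment_eq_real_ivl split: if_splits)
      moreover have "\<bar>Im (Ln x)\<bar> \<le> pi" using mpi_less_Im_Ln[OF x] Im_Ln_le_pi[OF x] by auto
      ultimately have "\<bar>Im (Ln x) * Im s\<bar> \<le> C"
        unfolding abs_mult C_def by (intro mult_mono) auto
      hence "Im s * Im (Ln x) \<le> C" by (subst mult.commute) (rule abs_le_D1)
      moreover have "Re (- s * Ln x) = Im (Ln x) * Im s - l * R"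
        using x by (simp add: s l_def mult.commute)
      ultimately have num: "norm (x powr (- s)) \<le> exp (C - l * R)"
        using x by (simp add: powr_def del: mult_minus_left)
      have "1 \<le> norm (s + y)" if "y \<in> X" for y
      proof -
        have "norm y \<le> (\<Sum>y\<in>X. norm y)" using that assms(1) by (intro member_le_sum) auto
        hence "1 \<le> \<bar>Re (s + y)\<bar>" using elim(2) abs_Re_le_cmod[of y] by (simp add: s)
        thus ?thesis using abs_Re_le_cmod[of "s + y"] by linarith
      qed
      hence den: "1 \<le> norm (\<Prod>y\<in>X. s + y)" by (simp add: prod_ge_1 flip: prod_norm)
      show "norm (x powr (- s) / (\<Prod>y\<in>X. s + y)) \<le> exp (C - l * R)"
        unfolding norm_divide using frac_le[OF exp_ge_zero num zero_less_one den] by simp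
    qed (rule exp_ge_zero)
    also have "Complex (- R) c - Complex (- R) b = \<i> * of_real (c - b)"
      by (simp add: complex_eq_iff)
    finally show ?case by (simp only: norm_mult norm_ii norm_of_real mult_1)
  qed
qed

text \<open>Cauchy's formula on the closed loop gives the remainder, and the closing segment is
  negligible. That segment may run through Gamma poles, so the closed loop is treated with the
  rational form \<open>g\<close>, and the Meijer integrand is compared with \<open>g\<close> on the
  truncated loop only.\<close>

lemma meijer_loop_integral_tendsto:
  fixes \<rho> :: "nat \<Rightarrow> nat"
  assumes "noncongruent \<omega> {..M}" "norm z < 1" "norm (1 - z) < 1"
    and "meijer_loop (M + 1) 0 as (map \<omega> [0..<M + 1]) \<gamma>"
  defines "as' \<equiv> map (\<lambda>k. \<omega> k + of_nat (\<rho> k) + 1) [0..<M + 1]"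
  shows "((\<lambda>R. 1 / (2 * of_real pi * \<i>) * contour_integral (loop_trunc \<gamma> R)
      (meijer_integrand (M + 1) 0 as' (map \<omega> [0..<M + 1]) (1 - z))) \<longlongrightarrow> rem (node_set \<omega> \<rho> {..M}) z) at_top"
proof -
  define X where "X = node_set \<omega> \<rho> {..M}"
  define L where "L = meijer_left_poles (M + 1) (map \<omega> [0..<M + 1])"
  define g where "g = (\<lambda>s. (1 - z) powr (- s) / (\<Prod>y\<in>X. s + y))"
  define V where "V = (\<lambda>R. linepath (Complex (- R) (Im (pathfinish \<gamma>))) (Complex (- R) (Im (pathstart \<gamma>))))"
  have z: "z \<noteq> 1" using assms(2) by auto
  have \<gamma>: "valid_path \<gamma>" using assms(4) by (simp add: meijer_loop_def)
  have L: "\<forall>\<^sub>F R in at_top. p \<notin> path_image (loop_closed \<gamma> R) \<and> winding_number (loop_closed \<gamma> R) p = 1"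
    if "p \<in> L" for p
    using assms(4) that by (auto simp: meijer_loop_def L_def simp del: upt_Suc)
  have XL: "- x \<in> L" if x: "x \<in> X" for x
  proof -
    obtain m r where "m \<le> M" "x = \<omega> m + of_nat r"
      using x by (auto simp: X_def node_set_def node_block_def)
    hence "- x = - (map \<omega> [0..<M + 1] ! m) - of_nat r" "m < M + 1" by (auto simp del: upt_Suc)
    thus ?thesis unfolding L_def meijer_left_poles_def by blast
  qed
  \<comment> \<open>The rational form has only finitely many poles, so the loop conditions hold at
    all of them simultaneously for large \<open>R\<close>.\<close>
  have "\<forall>\<^sub>F R in at_top. \<forall>x\<in>X. - x \<notin> path_image (loop_closed \<gamma> R) \<and> winding_number (loop_closed \<gamma> R) (- x) = 1"
    by (intro eventually_ball_finite) (auto simp: X_def intro: L XL[unfolded X_def])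
  moreover have "\<forall>\<^sub>F R in at_top. R \<ge> - Re (pathstart \<gamma>)" "\<forall>\<^sub>F R in at_top. R \<ge> - Re (pathfinish \<gamma>)"
    by (rule eventually_ge_at_top)+
  ultimately have ev: "\<forall>\<^sub>F R in at_top. g contour_integrable_on V R \<and>
    1 / (2 * of_real pi * \<i>) * contour_integral (loop_trunc \<gamma> R)
      (meijer_integrand (M + 1) 0 as' (map \<omega> [0..<M + 1]) (1 - z)) =
    rem X z - 1 / (2 * of_real pi * \<i>) * contour_integral (V R) g"
  proof eventually_elim
    case (elim R)
    have vp: "valid_path (loop_trunc \<gamma> R)" "valid_path (V R)"
      using \<gamma> by (auto simp: V_def valid_path_loop_trunc)
    have lc: "loop_closed \<gamma> R = loop_trunc \<gamma> R +++ V R" by (simp add: loop_closed_def V_def)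
    have hc: "(g has_contour_integral 2 * of_real pi * \<i> * rem X z) (loop_closed \<gamma> R)"
      unfolding g_def
    proof (rule has_contour_integral_reflected)
      show "valid_path (loop_closed \<gamma> R)"
        unfolding lc using vp by (intro valid_path_join) (auto simp: V_def loop_trunc_ends)
      show "pathfinish (loop_closed \<gamma> R) = pathstart (loop_closed \<gamma> R)"
        by (simp add: lc V_def loop_trunc_ends)
    qed (use elim(1) z in \<open>auto simp: X_def\<close>)
    hence "g contour_integrable_on (loop_trunc \<gamma> R +++ V R)"
      unfolding lc contour_integrable_on_def by blast
    note int = contour_integrable_joinD1[OF this vp(1)] contour_integrable_joinD2[OF this vp(2)]
    have "path_image (loop_trunc \<gamma> R) \<inter> L = {}"
      by (rule loop_trunc_avoids[OF eventually_mono[OF L] \<gamma> elim(2,3)]) auto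
    hence "contour_integral (loop_trunc \<gamma> R) (meijer_integrand (M + 1) 0 as' (map \<omega> [0..<M + 1]) (1 - z))
        = contour_integral (loop_trunc \<gamma> R) g"
      unfolding as'_def g_def X_def L_def
      by (intro contour_integral_cong refl meijer_integrand_eq assms(1)) blast
    also have "\<dots> = 2 * of_real pi * \<i> * rem X z - contour_integral (V R) g"
      using contour_integral_unique[OF hc] unfolding lc contour_integral_join[OF int vp]
      by (simp only: eq_diff_eq)
    finally show ?case using int by (simp add: right_diff_distrib)
  qed
  have "((\<lambda>R. contour_integral (V R) g) \<longlongrightarrow> 0) at_top"
    unfolding V_def g_def
  proof (rule closing_segment_tendsto_0)
    show "\<forall>\<^sub>F R in at_top. (\<lambda>s. (1 - z) powr (- s) / (\<Prod>y\<in>X. s + y)) contour_integrable_on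
      linepath (Complex (- R) (Im (pathfinish \<gamma>))) (Complex (- R) (Im (pathstart \<gamma>)))"
      using ev unfolding V_def g_def by (rule eventually_mono) blast
  qed (use assms z in \<open>auto simp: X_def\<close>)
  hence "((\<lambda>R. rem X z - 1 / (2 * of_real pi * \<i>) * contour_integral (V R) g) \<longlongrightarrow>
    rem X z - 1 / (2 * of_real pi * \<i>) * 0) at_top"
    by (intro tendsto_intros)
  hence "((\<lambda>R. rem X z - 1 / (2 * of_real pi * \<i>) * contour_integral (V R) g) \<longlongrightarrow> rem X z) at_top"
    by simp
  thus ?thesis unfolding X_def[symmetric]
    by (rule Lim_transform_eventually) (use ev in \<open>auto elim: eventually_mono\<close>)
qed

text \<open>All admissible loops give the same limit, and since one exists, uniqueness of limits
  determines the value \<open>I\<close>.\<close>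

lemma rem_eq_meijer_G:
  fixes \<rho> :: "nat \<Rightarrow> nat"
  assumes "noncongruent \<omega> {..M}" "norm z < 1" "norm (1 - z) < 1"
  shows "rem (node_set \<omega> \<rho> {..M}) z =
    meijer_G (M + 1) 0 (map (\<lambda>k. \<omega> k + of_nat (\<rho> k) + 1) [0..<M + 1]) (map \<omega> [0..<M + 1]) (1 - z)"
  unfolding meijer_G_def
proof (rule the_equality[symmetric], intro conjI allI impI)
  let ?as = "map (\<lambda>k. \<omega> k + of_nat (\<rho> k) + 1) [0..<M + 1]" and ?bs = "map \<omega> [0..<M + 1]"
  show "\<exists>\<gamma>. meijer_loop (M + 1) 0 ?as ?bs \<gamma>" by (rule exists_meijer_loop)
  show "((\<lambda>R. 1 / (2 * of_real pi * \<i>) * contour_integral (loop_trunc \<gamma> R)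
      (meijer_integrand (M + 1) 0 ?as ?bs (1 - z))) \<longlongrightarrow> rem (node_set \<omega> \<rho> {..M}) z) at_top"
    if "meijer_loop (M + 1) 0 ?as ?bs \<gamma>" for \<gamma>
    using assms that by (rule meijer_loop_integral_tendsto)
  fix I assume "(\<exists>\<gamma>. meijer_loop (M + 1) 0 ?as ?bs \<gamma>) \<and>
       (\<forall>\<gamma>. meijer_loop (M + 1) 0 ?as ?bs \<gamma> \<longrightarrow>
          ((\<lambda>R. 1 / (2 * of_real pi * \<i>) *
             contour_integral (loop_trunc \<gamma> R) (meijer_integrand (M + 1) 0 ?as ?bs (1 - z))) \<longlongrightarrow> I) at_top)"
  then obtain \<gamma> where \<gamma>: "meijer_loop (M + 1) 0 ?as ?bs \<gamma>"
    "((\<lambda>R. 1 / (2 * of_real pi * \<i>) *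
       contour_integral (loop_trunc \<gamma> R) (meijer_integrand (M + 1) 0 ?as ?bs (1 - z))) \<longlongrightarrow> I) at_top"
    by blast
  show "I = rem (node_set \<omega> \<rho> {..M}) z"
    by (rule tendsto_unique[OF _ \<gamma>(2) meijer_loop_integral_tendsto[OF assms \<gamma>(1)]]) simp
qed

section \<open>The five representations together\<close>

theorem theorem4:
  fixes M :: nat and \<omega> :: "nat \<Rightarrow> complex" and \<rho> :: "nat \<Rightarrow> nat"
  assumes "inj_on \<omega> {..M}"
    and "\<And>i j. i \<le> M \<Longrightarrow> j \<le> M \<Longrightarrow> i \<noteq> j \<Longrightarrow> \<omega> i - \<omega> j \<notin> \<int>"
  shows
    "(\<forall>z \<in> slit_plane.
        iter_integrable (segment_integrand M \<omega> \<rho>) 0 M (\<lambda>_. z) \<and>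
        Pade_Rem M \<omega> \<rho> z =
          (1 - z) powr \<omega> 0 / vec_fact M \<rho> *
          iter_integral (segment_integrand M \<omega> \<rho>) 0 M (\<lambda>_. z))
     \<and>
     (\<forall>z \<in> slit_plane.
        set_integrable (\<Pi>\<^sub>M h\<in>{1..M}. lborel) (\<Pi>\<^sub>E h\<in>{1..M}. {0..1}) (cube_integrand M \<omega> \<rho> z) \<and>
        Pade_Rem M \<omega> \<rho> z =
          z ^ (vec_size M \<rho> - 1) * ((1 - z) powr \<omega> 0 / vec_fact M \<rho>) *
          (LINT u:(\<Pi>\<^sub>E h\<in>{1..M}. {0..1})|(\<Pi>\<^sub>M h\<in>{1..M}. lborel). cube_integrand M \<omega> \<rho> z u))
     \<and>
     (\<forall>z \<in> slit_plane. \<forall>\<gamma>.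
        simple_pos_contour \<gamma> \<and>
        (\<forall>m\<le>M. \<forall>r\<le>\<rho> m. \<omega> m + of_nat r \<in> inside (path_image \<gamma>)) \<longrightarrow>
        (\<lambda>\<xi>. (1 - z) powr \<xi> * (\<Prod>k\<le>M. 1 / ffact (\<xi> - \<omega> k) (\<rho> k + 1)))
          contour_integrable_on \<gamma> \<and>
        Pade_Rem M \<omega> \<rho> z =
          (- 1) ^ (vec_size M \<rho> - 1) / (2 * of_real pi * \<i>) *
          contour_integral \<gamma>
            (\<lambda>\<xi>. (1 - z) powr \<xi> * (\<Prod>k\<le>M. 1 / ffact (\<xi> - \<omega> k) (\<rho> k + 1))))
     \<and>
     (let c = (\<lambda>n. (- 1) ^ n *
                (\<Sum>m\<le>M. 1 / fact (\<rho> m) *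
                  (\<Sum>r\<le>\<rho> m. of_nat (\<rho> m choose r) *
                    ((- 1) ^ r * ffact (\<omega> m + of_nat r) n /
                     (\<Prod>k\<in>{..M} - {m}. pochhammer (\<omega> k - \<omega> m - of_nat r) (\<rho> k + 1))))))
      in (\<forall>n. (deriv ^^ n) (Pade_Rem M \<omega> \<rho>) 0 = c n) \<and>
         (\<forall>z. norm z < 1 \<longrightarrow> (\<lambda>n. c n * (z ^ n / fact n)) sums Pade_Rem M \<omega> \<rho> z))
     \<and>
     (\<forall>z. norm z < 1 \<and> norm (1 - z) < 1 \<longrightarrow>
        Pade_Rem M \<omega> \<rho> z =
          meijer_G (M + 1) 0 (map (\<lambda>k. \<omega> k + of_nat (\<rho> k) + 1) [0..<M + 1])
            (map \<omega> [0..<M + 1]) (1 - z))"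
proof (intro conjI)
  let ?X = "node_set \<omega> \<rho> {..M}"
  have nc: "noncongruent \<omega> {..M}" using assms(2) by (auto simp: noncongruent_def)
  have ne: "z \<noteq> 1" if "z \<in> slit_plane" for z using that by (auto simp: slit_plane_iff)
  show "\<forall>z \<in> slit_plane. iter_integrable (segment_integrand M \<omega> \<rho>) 0 M (\<lambda>_. z) \<and>
        Pade_Rem M \<omega> \<rho> z =
          (1 - z) powr \<omega> 0 / vec_fact M \<rho> * iter_integral (segment_integrand M \<omega> \<rho>) 0 M (\<lambda>_. z)"
    using rem_eq_iter_integral[OF nc] Pade_Rem_eq_rem[OF nc ne] by simp
  show "\<forall>z \<in> slit_plane.
        set_integrable (\<Pi>\<^sub>M h\<in>{1..M}. lborel) (\<Pi>\<^sub>E h\<in>{1..M}. {0..1}) (cube_integrand M \<omega> \<rho> z) \<and>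
        Pade_Rem M \<omega> \<rho> z =
          z ^ (vec_size M \<rho> - 1) * ((1 - z) powr \<omega> 0 / vec_fact M \<rho>) *
          (LINT u:(\<Pi>\<^sub>E h\<in>{1..M}. {0..1})|(\<Pi>\<^sub>M h\<in>{1..M}. lborel). cube_integrand M \<omega> \<rho> z u)"
    using set_integrable_cube_integrand[OF nc] rem_eq_cube_integral[OF nc] Pade_Rem_eq_rem[OF nc ne] by simp
  show "\<forall>z \<in> slit_plane. \<forall>\<gamma>.
        simple_pos_contour \<gamma> \<and>
        (\<forall>m\<le>M. \<forall>r\<le>\<rho> m. \<omega> m + of_nat r \<in> inside (path_image \<gamma>)) \<longrightarrow>
        (\<lambda>\<xi>. (1 - z) powr \<xi> * (\<Prod>k\<le>M. 1 / ffact (\<xi> - \<omega> k) (\<rho> k + 1)))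
          contour_integrable_on \<gamma> \<and>
        Pade_Rem M \<omega> \<rho> z =
          (- 1) ^ (vec_size M \<rho> - 1) / (2 * of_real pi * \<i>) *
          contour_integral \<gamma>
            (\<lambda>\<xi>. (1 - z) powr \<xi> * (\<Prod>k\<le>M. 1 / ffact (\<xi> - \<omega> k) (\<rho> k + 1)))"
  proof (intro ballI allI impI)
    fix z \<gamma> assume z: "z \<in> slit_plane"
      and \<gamma>: "simple_pos_contour \<gamma> \<and> (\<forall>m\<le>M. \<forall>r\<le>\<rho> m. \<omega> m + of_nat r \<in> inside (path_image \<gamma>))"
    hence ins: "?X \<subseteq> inside (path_image \<gamma>)" by (auto simp: node_set_def node_block_def)
    hence "?X \<inter> path_image \<gamma> = {}" using inside_no_overlap[of "path_image \<gamma>"] by blast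
    moreover have "valid_path \<gamma>" "pathfinish \<gamma> = pathstart \<gamma>" "\<And>x. x \<in> ?X \<Longrightarrow> winding_number \<gamma> x = 1"
      using \<gamma> ins unfolding simple_pos_contour_def by blast+
    ultimately show "(\<lambda>\<xi>. (1 - z) powr \<xi> * (\<Prod>k\<le>M. 1 / ffact (\<xi> - \<omega> k) (\<rho> k + 1)))
          contour_integrable_on \<gamma> \<and>
        Pade_Rem M \<omega> \<rho> z =
          (- 1) ^ (vec_size M \<rho> - 1) / (2 * of_real pi * \<i>) *
          contour_integral \<gamma>
            (\<lambda>\<xi>. (1 - z) powr \<xi> * (\<Prod>k\<le>M. 1 / ffact (\<xi> - \<omega> k) (\<rho> k + 1)))"
      using rem_eq_contour_integral[OF nc ne[OF z], of \<gamma> \<rho>] Pade_Rem_eq_rem[OF nc ne[OF z]] by simp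
  qed
  \<comment> \<open>Writing out the weights by \<open>wt_node_set\<close> gives the stated
    coefficients; the derivatives at \<open>0\<close> and the expansion then both follow from the
    series of \<open>rem\<close>.\<close>
  have coeff: "rem_coeff ?X n = (- 1) ^ n *
      (\<Sum>m\<le>M. 1 / fact (\<rho> m) *
        (\<Sum>r\<le>\<rho> m. of_nat (\<rho> m choose r) *
          ((- 1) ^ r * ffact (\<omega> m + of_nat r) n /
           (\<Prod>k\<in>{..M} - {m}. pochhammer (\<omega> k - \<omega> m - of_nat r) (\<rho> k + 1)))))" for n
    unfolding rem_coeff_def dd_def sum_node_set[OF finite_atMost nc] sum_distrib_left
    by (intro sum.cong refl) (subst wt_node_set[OF finite_atMost nc], auto)
  have sums: "(\<lambda>n. rem_coeff ?X n * (z ^ n / fact n)) sums Pade_Rem M \<omega> \<rho> z" if "norm z < 1" for z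
    using rem_sums[OF that] Pade_Rem_eq_rem[OF nc ne[OF unit_disc_slit_plane[OF that]]] by simp
  show "let c = (\<lambda>n. (- 1) ^ n *
                (\<Sum>m\<le>M. 1 / fact (\<rho> m) *
                  (\<Sum>r\<le>\<rho> m. of_nat (\<rho> m choose r) *
                    ((- 1) ^ r * ffact (\<omega> m + of_nat r) n /
                     (\<Prod>k\<in>{..M} - {m}. pochhammer (\<omega> k - \<omega> m - of_nat r) (\<rho> k + 1))))))
      in (\<forall>n. (deriv ^^ n) (Pade_Rem M \<omega> \<rho>) 0 = c n) \<and>
         (\<forall>z. norm z < 1 \<longrightarrow> (\<lambda>n. c n * (z ^ n / fact n)) sums Pade_Rem M \<omega> \<rho> z)"
    unfolding Let_def coeff[symmetric] using higher_deriv_of_sums[OF sums] sums by blast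
  show "\<forall>z. norm z < 1 \<and> norm (1 - z) < 1 \<longrightarrow>
        Pade_Rem M \<omega> \<rho> z =
          meijer_G (M + 1) 0 (map (\<lambda>k. \<omega> k + of_nat (\<rho> k) + 1) [0..<M + 1])
            (map \<omega> [0..<M + 1]) (1 - z)"
    using rem_eq_meijer_G[OF nc] Pade_Rem_eq_rem[OF nc ne[OF unit_disc_slit_plane]]
    by (simp del: upt_Suc)
qed

end
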